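(* $\psi_2(8)>\psi_3(8)$.
   Context: A packing of the unit square $[0,1]^2$ by $n$ squares is a collection of $n$ squares (of positive side length) contained in the unit square with pairwise disjoint interiors. A right packing is a packing by squares whose sides are parallel to the sides of the unit square. A right tiling is a right packing whose squares completely fill (cover) the unit square. If the squares have side lengths $s_1,\dots,s_n$, then $\psi_2(n)$ is defined as $\max\sum_{i=1}^n s_i$, the maximum being over all right packings of the unit square with exactly $n$ squares, and, for $n\neq 2,3,5$, $\psi_3(n)$ is defined as $\max\sum_{i=1}^n s_i$, the maximum being over all right tilings of the unit square with exactly $n$ squares. *)

theory Defs
  imports "HOL-Analysis.Analysis"
begin

text \<open>The closed square of side \<open>s\<close> with sides parallel to the axes and lower left corner \<open>p\<close>.\<close>

definition right_square :: "real \<times> real \<Rightarrow> real \<Rightarrow> (real \<times> real) set" where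
  "right_square p s = cbox p (p + (s, s))"

abbreviation unit_square :: "(real \<times> real) set" where
  "unit_square \<equiv> cbox (0, 0) (1, 1)"

definition right_packing :: "nat \<Rightarrow> (nat \<Rightarrow> real \<times> real) \<Rightarrow> (nat \<Rightarrow> real) \<Rightarrow> bool" where
  "right_packing n p s \<longleftrightarrow>
     (\<forall>i<n. 0 < s i \<and> right_square (p i) (s i) \<subseteq> unit_square) \<and>
     disjoint_family_on (\<lambda>i. interior (right_square (p i) (s i))) {..<n}"

definition right_tiling :: "nat \<Rightarrow> (nat \<Rightarrow> real \<times> real) \<Rightarrow> (nat \<Rightarrow> real) \<Rightarrow> bool" where
  "right_tiling n p s \<longleftrightarrow>
     right_packing n p s \<and> (\<Union>i<n. right_square (p i) (s i)) = unit_square"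

text \<open>
  Both maxima are taken over infinite sets of real numbers, so \<open>Max\<close> does not apply;
  \<open>GREATEST\<close> denotes the attained maximum and is unspecified if there is none.
  In particular, \<open>psi3 n\<close> is unspecified for \<open>n \<in> {0, 2, 3, 5}\<close>, where no tiling exists.
\<close>

definition psi2 :: "nat \<Rightarrow> real" where
  "psi2 n = (GREATEST t. \<exists>p s. right_packing n p s \<and> t = (\<Sum>i<n. s i))"

definition psi3 :: "nat \<Rightarrow> real" where
  "psi3 n = (GREATEST t. \<exists>p s. right_tiling n p s \<and> t = (\<Sum>i<n. s i))"

end

theory Submission
  imports Defs
begin

text \<open>
  Deleting a cell of the \<open>3 \<times> 3\<close> grid shows that eight packed squares can have total side \<open>8/3\<close>. A
  maximum over packings exists by compactness: in a limit of packings no square degenerates, because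
  seven squares have total side at most \<open>\<surd>7 < 8/3\<close> by Cauchy-Schwarz.

  A tiling by eight squares has total side at most \<open>13/5\<close>, with equality for the side lengths
  \<open>3/5, 2/5, 2/5, 2/5, 1/5, 1/5, 1/5, 1/5\<close>. The tools are that the area is 1 and that the sides of the
  squares crossing a horizontal or vertical line sum to 1. If a corner square has side
  \<open>1 - w > 1/2\<close>, all others have side at most \<open>w\<close>; summing \<open>s (w - s) \<le> w\<^sup>2 / 4\<close> over them bounds the
  total side by \<open>3 - 2 w + (7 - f) w / 4\<close>, where \<open>f\<close> counts the squares of side exactly \<open>w\<close>. Lines and
  the area give \<open>f \<ge> 4\<close>, or \<open>f = 3\<close> and \<open>w \<ge> 2/5\<close> (for \<open>w < 1/3\<close> even \<open>f \<ge> 6\<close>, and \<open>w \<ge> 1/4\<close>). If all corner squares have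
  side at most \<open>1/2\<close>, then either two of them fill a side and the other half is treated by counting
  squares along two lines, or each side has exactly one further square and there is no interior
  square, which is impossible.
\<close>

section \<open>Length and area inequalities from Lebesgue measure\<close>

lemma sum_measure_le:
  assumes "finite I" "disjoint_family_on B I" "\<And>i. i \<in> I \<Longrightarrow> B i \<subseteq> C"
    "\<And>i. i \<in> I \<Longrightarrow> B i \<in> fmeasurable M" "C \<in> fmeasurable M"
  shows "(\<Sum>i\<in>I. measure M (B i)) \<le> measure M C"
proof -
  have "(\<Sum>i\<in>I. measure M (B i)) = measure M (\<Union>i\<in>I. B i)"
    using assms by (intro measure_finite_Union[symmetric]) (auto simp: fmeasurable_def less_top)
  also have "\<dots> \<le> measure M C"
    using assms by (intro measure_mono_fmeasurable) (auto intro!: sets.finite_UN fmeasurableD)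
  finally show ?thesis .
qed

lemma measure_le_sum:
  assumes "finite I" "C \<subseteq> (\<Union>i\<in>I. B i)"
    "\<And>i. i \<in> I \<Longrightarrow> B i \<in> fmeasurable M" "C \<in> fmeasurable M"
  shows "measure M C \<le> (\<Sum>i\<in>I. measure M (B i))"
proof -
  have "measure M C \<le> measure M (\<Union>i\<in>I. B i)"
    using assms by (intro measure_mono_fmeasurable) (auto intro!: fmeasurableD fmeasurable.finite_UN)
  also have "\<dots> \<le> (\<Sum>i\<in>I. measure M (B i))"
    using assms by (intro measure_UNION_le) (auto intro!: fmeasurableD)
  finally show ?thesis .
qed

lemma sum_interval_lengths_le:
  fixes x s :: "'i \<Rightarrow> real"
  assumes "finite I" "\<And>i. i \<in> I \<Longrightarrow> 0 \<le> s i" "\<And>i. i \<in> I \<Longrightarrow> \<alpha> \<le> x i \<and> x i + s i \<le> \<beta>"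
    and "\<And>i j. i \<in> I \<Longrightarrow> j \<in> I \<Longrightarrow> i \<noteq> j \<Longrightarrow> x i + s i \<le> x j \<or> x j + s j \<le> x i" "\<alpha> \<le> \<beta>"
  shows "(\<Sum>i\<in>I. s i) \<le> \<beta> - \<alpha>"
proof -
  have "(\<Sum>i\<in>I. measure lborel {x i<..<x i + s i}) \<le> measure lborel {\<alpha>..\<beta>}"
    using assms(1)
  proof (rule sum_measure_le)
    show "disjoint_family_on (\<lambda>i. {x i<..<x i + s i}) I"
      unfolding disjoint_family_on_def
    proof (intro ballI impI)
      fix i j assume "i \<in> I" "j \<in> I" "i \<noteq> j"
      from assms(4)[OF this]
      show "{x i<..<x i + s i} \<inter> {x j<..<x j + s j} = {}" by auto
    qed
    show "{x i<..<x i + s i} \<subseteq> {\<alpha>..\<beta>}" if "i \<in> I" for i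
      using assms(3)[OF that] by auto
  qed (auto simp: fmeasurable_def emeasure_bounded_finite[unfolded infinity_ennreal_def])
  then show ?thesis
    using assms by simp
qed

lemma sum_interval_lengths_ge:
  fixes x s :: "'i \<Rightarrow> real"
  assumes "finite I" "\<And>i. i \<in> I \<Longrightarrow> 0 \<le> s i" "\<alpha> \<le> \<beta>"
    and "\<And>u. \<alpha> \<le> u \<Longrightarrow> u < \<beta> \<Longrightarrow> \<exists>i\<in>I. x i \<le> u \<and> u \<le> x i + s i"
  shows "\<beta> - \<alpha> \<le> (\<Sum>i\<in>I. s i)"
proof -
  have "measure lborel {\<alpha>..<\<beta>} \<le> (\<Sum>i\<in>I. measure lborel {x i..x i + s i})"
    using assms(1)
  proof (rule measure_le_sum)
    show "{\<alpha>..<\<beta>} \<subseteq> (\<Union>i\<in>I. {x i..x i + s i})"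
      using assms(4) by auto
  qed (auto simp: fmeasurable_def emeasure_bounded_finite[unfolded infinity_ennreal_def])
  then show ?thesis
    using assms by simp
qed

text \<open>For positive sides this is disjointness of the interiors
  (\<open>squares_disjoint_iff\<close>). As a disjunction of weak linear inequalities it is a closed
  condition, so it survives limits of packings.\<close>

abbreviation separated :: "('i \<Rightarrow> real) \<Rightarrow> ('i \<Rightarrow> real) \<Rightarrow> ('i \<Rightarrow> real) \<Rightarrow> 'i \<Rightarrow> 'i \<Rightarrow> bool" where
  "separated x y s i j \<equiv>
     x i + s i \<le> x j \<or> x j + s j \<le> x i \<or> y i + s i \<le> y j \<or> y j + s j \<le> y i"

lemma measure_square: "0 \<le> s \<Longrightarrow> measure lborel (cbox (a, b) (a + s, b + s)) = s\<^sup>2" for s :: real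
  by (simp add: content_Pair power2_eq_square)

lemma measure_open_square: "0 \<le> s \<Longrightarrow> measure lborel (box (a, b) (a + s, b + s)) = s\<^sup>2" for s :: real
  by (subst measure_square[symmetric, of s a b])
     (simp_all only: measure_lborel_box_eq measure_lborel_cbox_eq)

lemma mem_box_pair: "(u, v) \<in> box (a, b) (c, d) \<longleftrightarrow> a < u \<and> u < c \<and> b < v \<and> v < d"
  for a b c d u v :: real
  by (auto simp: box_def Basis_prod_def)

lemma sum_squares_le_1:
  fixes x y s :: "'i \<Rightarrow> real"
  assumes "finite I" and pos: "\<And>i. i \<in> I \<Longrightarrow> 0 \<le> s i"
    and bounds: "\<And>i. i \<in> I \<Longrightarrow> 0 \<le> x i \<and> x i + s i \<le> 1 \<and> 0 \<le> y i \<and> y i + s i \<le> 1"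
    and sep: "\<And>i j. i \<in> I \<Longrightarrow> j \<in> I \<Longrightarrow> i \<noteq> j \<Longrightarrow> separated x y s i j"
  shows "(\<Sum>i\<in>I. (s i)\<^sup>2) \<le> 1"
proof -
  have "(\<Sum>i\<in>I. measure lborel (box (x i, y i) (x i + s i, y i + s i)))
      \<le> measure lborel (cbox (0::real, 0::real) (0 + 1, 0 + 1))"
    using assms(1)
  proof (rule sum_measure_le)
    show "disjoint_family_on (\<lambda>i. box (x i, y i) (x i + s i, y i + s i)) I"
      unfolding disjoint_family_on_def
    proof (intro ballI impI)
      fix i j assume "i \<in> I" "j \<in> I" "i \<noteq> j"
      from sep[OF this]
      show "box (x i, y i) (x i + s i, y i + s i) \<inter> box (x j, y j) (x j + s j, y j + s j) = {}"
        by (auto simp: mem_box_pair)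
    qed
    show "box (x i, y i) (x i + s i, y i + s i) \<subseteq> cbox (0, 0) (0 + 1, 0 + 1)" if "i \<in> I" for i
      using bounds[OF that] by (auto simp: mem_box_pair)
  qed (auto simp: fmeasurable_def emeasure_bounded_finite[unfolded infinity_ennreal_def])
  then show ?thesis
    using pos by (subst (asm) measure_square) (simp_all add: measure_open_square)
qed

text \<open>Each summand is at most \<open>w\<^sup>2 / 4\<close> by completing the square, and those
  over \<open>F\<close> vanish. When the area fixes the sum of squares, this becomes an upper bound
  on the total side.\<close>

lemma sum_mult_diff_le:
  fixes s :: "'i \<Rightarrow> real"
  assumes "finite R" "F \<subseteq> R" "\<And>i. i \<in> F \<Longrightarrow> s i = w"
  shows "(\<Sum>i\<in>R. s i * (w - s i)) \<le> real (card (R - F)) * (w\<^sup>2 / 4)"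
proof -
  have "(\<Sum>i\<in>R. s i * (w - s i)) = (\<Sum>i\<in>R - F. s i * (w - s i)) + (\<Sum>i\<in>F. s i * (w - s i))"
    by (rule sum.subset_diff[OF assms(2,1)])
  also have "\<dots> = (\<Sum>i\<in>R - F. s i * (w - s i))"
    using assms(3) by simp
  also have "\<dots> \<le> real (card (R - F)) * (w\<^sup>2 / 4)"
  proof (rule sum_bounded_above)
    fix i
    have "s i * (w - s i) = w\<^sup>2 / 4 - (w / 2 - s i)\<^sup>2"
      by (simp add: power2_eq_square field_simps)
    then show "s i * (w - s i) \<le> w\<^sup>2 / 4" by simp
  qed
  finally show ?thesis .
qed

section \<open>Tilings and the lines crossing them\<close>

text \<open>Plain coordinates make the axis exchange and the reflections instances of the same
  locale, so facts about the bottom side or the bottom left corner carry over to every side and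
  corner.\<close>

locale square_tiling =
  fixes I :: "'i set" and x y s :: "'i \<Rightarrow> real"
  assumes fin: "finite I"
    and pos: "i \<in> I \<Longrightarrow> 0 < s i"
    and bounds: "i \<in> I \<Longrightarrow> 0 \<le> x i \<and> x i + s i \<le> 1 \<and> 0 \<le> y i \<and> y i + s i \<le> 1"
    and sep: "i \<in> I \<Longrightarrow> j \<in> I \<Longrightarrow> i \<noteq> j \<Longrightarrow> separated x y s i j"
    and cover: "0 \<le> u \<Longrightarrow> u \<le> 1 \<Longrightarrow> 0 \<le> v \<Longrightarrow> v \<le> 1 \<Longrightarrow>
      \<exists>i\<in>I. x i \<le> u \<and> u \<le> x i + s i \<and> y i \<le> v \<and> v \<le> y i + s i"
begin

lemma swap: "square_tiling I y x s"
proof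
  show "separated y x s i j" if "i \<in> I" "j \<in> I" "i \<noteq> j" for i j
    using sep[OF that] by blast
  show "\<exists>i\<in>I. y i \<le> u \<and> u \<le> y i + s i \<and> x i \<le> v \<and> v \<le> x i + s i"
    if "0 \<le> u" "u \<le> 1" "0 \<le> v" "v \<le> 1" for u v
    using cover[of v u] that by blast
qed (use fin pos bounds in simp_all)

lemma flip_x: "square_tiling I (\<lambda>i. 1 - x i - s i) y s"
proof
  show "separated (\<lambda>i. 1 - x i - s i) y s i j" if "i \<in> I" "j \<in> I" "i \<noteq> j" for i j
    using sep[OF that] by linarith
  show "0 \<le> 1 - x i - s i \<and> 1 - x i - s i + s i \<le> 1 \<and> 0 \<le> y i \<and> y i + s i \<le> 1" if "i \<in> I" for i
    using bounds[OF that] by linarith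
  fix u v :: real assume "0 \<le> u" "u \<le> 1" "0 \<le> v" "v \<le> 1"
  then obtain i where "i \<in> I" "x i \<le> 1 - u \<and> 1 - u \<le> x i + s i \<and> y i \<le> v \<and> v \<le> y i + s i"
    using cover[of "1 - u" v] by auto
  then show "\<exists>i\<in>I. 1 - x i - s i \<le> u \<and> u \<le> 1 - x i - s i + s i \<and> y i \<le> v \<and> v \<le> y i + s i"
    by (intro bexI[of _ i]) auto
qed (use fin pos in auto)

lemma flip_y: "square_tiling I x (\<lambda>i. 1 - y i - s i) s"
  by (rule square_tiling.swap[OF square_tiling.flip_x[OF swap]])

text \<open>Shift the point by \<open>(e, e)\<close> with small \<open>e > 0\<close>. A square whose
  half-open version misses \<open>(u, v)\<close> misses the shifted point for all small
  \<open>e\<close>, and there are only finitely many squares, so the shifted point would be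
  uncovered.\<close>

lemma half_open_cover:
  assumes "0 \<le> u" "u < 1" "0 \<le> v" "v < 1"
  shows "\<exists>i\<in>I. x i \<le> u \<and> u < x i + s i \<and> y i \<le> v \<and> v < y i + s i"
proof (rule ccontr)
  assume H: "\<not> ?thesis"
  have "eventually (\<lambda>e. e \<in> {0<..<min (1 - u) (1 - v)}) (at_right (0::real))"
    using assms by (intro eventually_at_right_real) auto
  moreover have "eventually (\<lambda>e. \<forall>i\<in>I. \<not> (x i \<le> u + e \<and> u + e \<le> x i + s i \<and>
      y i \<le> v + e \<and> v + e \<le> y i + s i)) (at_right (0::real))"
  proof (rule eventually_ball_finite[OF fin], rule ballI)
    fix i assume "i \<in> I"
    then consider "u < x i" | "x i + s i \<le> u" | "v < y i" | "y i + s i \<le> v"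
      using H by force
    then obtain d where d: "0 < d" and "u + d \<le> x i \<or> x i + s i \<le> u \<or> v + d \<le> y i \<or> y i + s i \<le> v"
    proof cases
      case 1 then show ?thesis by (intro that[of "x i - u"]) auto
    next
      case 3 then show ?thesis by (intro that[of "y i - v"]) auto
    qed (auto intro: that[of 1])
    then show "eventually (\<lambda>e. \<not> (x i \<le> u + e \<and> u + e \<le> x i + s i \<and>
      y i \<le> v + e \<and> v + e \<le> y i + s i)) (at_right (0::real))"
      by (intro eventually_mono[OF eventually_at_right_real[OF d]]) auto
  qed
  ultimately have "eventually (\<lambda>e. False) (at_right (0::real))"
  proof eventually_elim
    case (elim e)
    then show ?case
      using cover[of "u + e" "v + e"] assms by auto
  qed
  then show False by simp
qed

text \<open>Squares crossed by one horizontal line cannot be separated vertically, so their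
  projections to the x-axis do not overlap.\<close>

lemma sum_crossing_le:
  assumes "J \<subseteq> I" "\<And>i. i \<in> J \<Longrightarrow> y i \<le> t \<and> t < y i + s i"
    "\<And>i. i \<in> J \<Longrightarrow> \<alpha> \<le> x i \<and> x i + s i \<le> \<beta>" "\<alpha> \<le> \<beta>"
  shows "sum s J \<le> \<beta> - \<alpha>"
proof (rule sum_interval_lengths_le)
  show "finite J" using assms(1) fin finite_subset by blast
  show "x i + s i \<le> x j \<or> x j + s j \<le> x i" if "i \<in> J" "j \<in> J" "i \<noteq> j" for i j
    using sep[of i j] that assms(1) assms(2)[of i] assms(2)[of j] by force
qed (use assms pos in \<open>auto simp: less_imp_le subset_iff\<close>)

text \<open>The half-open condition keeps the identity exact on lines that run along sides of
  squares: squares resting on the line count, squares ending at it do not.\<close>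

lemma sum_crossing:
  assumes "0 \<le> t" "t < 1"
  shows "sum s {i\<in>I. y i \<le> t \<and> t < y i + s i} = 1"
proof (rule antisym)
  have "sum s {i\<in>I. y i \<le> t \<and> t < y i + s i} \<le> 1 - 0"
    by (rule sum_crossing_le[of _ t]) (simp_all add: bounds)
  then show "sum s {i\<in>I. y i \<le> t \<and> t < y i + s i} \<le> 1" by simp
  have "1 - 0 \<le> sum s {i\<in>I. y i \<le> t \<and> t < y i + s i}"
  proof (rule sum_interval_lengths_ge)
    fix u :: real assume "0 \<le> u" "u < 1"
    from half_open_cover[OF this assms] obtain i
      where "i \<in> I" "x i \<le> u" "u < x i + s i" "y i \<le> t" "t < y i + s i" by blast
    then show "\<exists>i\<in>{i\<in>I. y i \<le> t \<and> t < y i + s i}. x i \<le> u \<and> u \<le> x i + s i"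
      by (intro bexI[of _ i]) (simp_all add: less_imp_le)
  qed (simp_all add: fin pos less_imp_le)
  then show "1 \<le> sum s {i\<in>I. y i \<le> t \<and> t < y i + s i}" by simp
qed

lemma sum_bottom: "sum s {i\<in>I. y i = 0} = 1"
proof -
  have "{i\<in>I. y i \<le> 0 \<and> 0 < y i + s i} = {i\<in>I. y i = 0}"
    using bounds pos by (auto intro: antisym simp: add_nonneg_pos)
  then show ?thesis using sum_crossing[of 0] by simp
qed

lemma sum_left: "sum s {i\<in>I. x i = 0} = 1"
  by (rule square_tiling.sum_bottom[OF swap])

lemma sum_top: "sum s {i\<in>I. y i + s i = 1} = 1"
proof -
  have "{i\<in>I. 1 - y i - s i = 0} = {i\<in>I. y i + s i = 1}" by auto
  then show ?thesis using square_tiling.sum_bottom[OF flip_y] by simp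
qed

lemma sum_right: "sum s {i\<in>I. x i + s i = 1} = 1"
  by (rule square_tiling.sum_top[OF swap])

lemma area: "(\<Sum>i\<in>I. (s i)\<^sup>2) = 1"
proof (rule antisym)
  show "(\<Sum>i\<in>I. (s i)\<^sup>2) \<le> 1"
    by (rule sum_squares_le_1[OF fin less_imp_le[OF pos] bounds sep])
  have "measure lborel (cbox (0::real, 0::real) (0 + 1, 0 + 1))
      \<le> (\<Sum>i\<in>I. measure lborel (cbox (x i, y i) (x i + s i, y i + s i)))"
    using fin
  proof (rule measure_le_sum)
    show "cbox (0::real, 0::real) (0 + 1, 0 + 1) \<subseteq> (\<Union>i\<in>I. cbox (x i, y i) (x i + s i, y i + s i))"
    proof
      fix p assume p: "p \<in> cbox (0::real, 0::real) (0 + 1, 0 + 1)"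
      obtain u v where uv: "p = (u, v)" by (cases p)
      obtain i where "i \<in> I" "x i \<le> u \<and> u \<le> x i + s i \<and> y i \<le> v \<and> v \<le> y i + s i"
        using cover[of u v] p unfolding uv cbox_Pair_iff by auto
      then show "p \<in> (\<Union>i\<in>I. cbox (x i, y i) (x i + s i, y i + s i))"
        unfolding uv by (intro UN_I[of i]) (simp_all add: cbox_Pair_iff)
    qed
  qed (auto simp: fmeasurable_def emeasure_bounded_finite[unfolded infinity_ennreal_def])
  then show "1 \<le> (\<Sum>i\<in>I. (s i)\<^sup>2)"
    using pos by (subst (asm) measure_square) (simp_all add: measure_square less_imp_le)
qed

lemma bottom_left_corner: "\<exists>i\<in>I. x i = 0 \<and> y i = 0"
proof -
  obtain i where "i \<in> I" "x i \<le> 0" "y i \<le> 0"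
    using half_open_cover[of 0 0] by auto
  then show ?thesis using bounds[of i] by (intro bexI[of _ i]) auto
qed

end

section \<open>A corner square of side greater than one half\<close>

locale big_corner = square_tiling I x y s for I :: "'i set" and x y s +
  fixes z
  assumes z: "z \<in> I" "x z = 0" "y z = 0" "1/2 < s z" and card_I: "card I = 8"
begin

lemma swap_big: "big_corner I y x s z"
  using z card_I swap by (simp add: big_corner_def big_corner_axioms_def)

text \<open>
  Outside the corner square \<open>z\<close> lie \<open>U\<close> (starting above \<open>z\<close>), \<open>V\<close> (starting to the right
  of \<open>z\<close>) and \<open>W\<close> (starting in the opposite corner). The suffixes \<open>T\<close>, \<open>R\<close>, \<open>B\<close> and \<open>F\<close> select the
  squares that touch the top side, touch the right side, rest on the line through the side of \<open>z\<close>, and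
  are full, i.e. have the largest possible side \<open>w\<close>. The names for \<open>V\<close> refer to the reflected tiling,
  so that \<open>VT\<close> touches the right side and \<open>VB\<close> touches the right side of \<open>z\<close>.
\<close>

definition "w = 1 - s z"
definition "U = {i\<in>I. x i < s z \<and> s z \<le> y i}"
definition "UT = {i\<in>U. y i + s i = 1}"
definition "UB = {i\<in>U. y i = s z}"
definition "UF = {i\<in>U. s i = w}"
definition "W = {i\<in>I. s z \<le> x i \<and> s z \<le> y i}"
definition "WT = {i\<in>W. y i + s i = 1}"
definition "WF = {i\<in>W. s i = w}"
abbreviation "V \<equiv> big_corner.U I y x s z"
abbreviation "VT \<equiv> big_corner.UT I y x s z"
abbreviation "VB \<equiv> big_corner.UB I y x s z"
abbreviation "VF \<equiv> big_corner.UF I y x s z"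
abbreviation "WR \<equiv> big_corner.WT I y x s z"

lemma V_def: "V = {i\<in>I. y i < s z \<and> s z \<le> x i}"
  by (rule big_corner.U_def[OF swap_big])
lemma WR_def: "WR = {i\<in>W. x i + s i = 1}"
  unfolding big_corner.WT_def[OF swap_big] big_corner.W_def[OF swap_big] W_def by auto

lemma W_swap: "big_corner.W I y x s z = W"
  unfolding big_corner.W_def[OF swap_big] W_def by auto
lemma outside:
  assumes "i \<in> I" "i \<noteq> z"
  shows "s z \<le> x i \<or> s z \<le> y i"
  using sep[of i z] assms z pos[OF assms(1)] bounds[OF assms(1)] by auto

lemma le_w: "i \<in> I \<Longrightarrow> i \<noteq> z \<Longrightarrow> s i \<le> w"
  using outside[of i] bounds[of i] by (auto simp: w_def)

lemma partition: "I = insert z (U \<union> V \<union> W)"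
  using outside z unfolding U_def V_def W_def by force

lemma not_z: "z \<notin> U" "z \<notin> V" "z \<notin> W"
  using z by (auto simp: U_def V_def W_def)

lemma sub_I: "U \<subseteq> I" "V \<subseteq> I" "W \<subseteq> I"
  by (auto simp: U_def V_def W_def)

lemma finite_parts: "finite U" "finite V" "finite W"
  using sub_I fin finite_subset by blast+

lemma disj: "U \<inter> V = {}" "(U \<union> V) \<inter> W = {}"
  by (auto simp: U_def V_def W_def)

lemma sum_partition: "sum g I = g z + sum g U + sum g V + sum g W" for g :: "'i \<Rightarrow> real"
proof -
  have "sum g I = sum g (insert z (U \<union> V \<union> W))"
    using partition by (rule arg_cong)
  then show ?thesis
    using not_z finite_parts disj by (simp add: sum.union_disjoint)
qed

lemma card_partition: "card U + card V + card W = 7"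
proof -
  have "card I = card (insert z (U \<union> V \<union> W))"
    using partition by (rule arg_cong)
  then show ?thesis
    using not_z finite_parts disj card_I by (simp add: card_Un_disjoint)
qed

lemma U_le_w: "i \<in> U \<Longrightarrow> s i \<le> w" and W_le_w: "i \<in> W \<Longrightarrow> s i \<le> w"
  using le_w not_z sub_I by blast+

lemma w_pos: "0 < w"
proof -
  have "U \<union> V \<union> W \<noteq> {}"
    using card_partition by (metis Un_empty card.empty add_cancel_left_left zero_neq_numeral)
  then obtain i where "i \<in> I" "i \<noteq> z" using sub_I not_z by blast
  then show ?thesis using le_w[of i] pos[of i] by simp
qed

lemma w_lt: "w < 1/2"
  using z by (simp add: w_def)

lemma top_sum: "sum s UT + sum s WT = 1"
proof -
  have "{i\<in>I. y i + s i = 1} = UT \<union> WT"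
  proof (rule set_eqI)
    fix i
    have "s z \<le> y i" if "i \<in> I" "y i + s i = 1"
      using le_w[OF that(1)] that z(3) w_pos by (cases "i = z") (auto simp: w_def)
    then show "i \<in> {i\<in>I. y i + s i = 1} \<longleftrightarrow> i \<in> UT \<union> WT"
      unfolding UT_def WT_def U_def W_def by force
  qed
  moreover have "UT \<inter> WT = {}" using disj by (auto simp: UT_def WT_def)
  ultimately show ?thesis
    using sum_top finite_parts by (simp add: sum.union_disjoint UT_def WT_def)
qed

text \<open>This is \<open>sum_crossing\<close> for the line along the upper side of
  \<open>z\<close>. Squares of \<open>U\<close> and \<open>W\<close> can meet it only by resting on
  it, whereas squares of \<open>V\<close> may cross it from below.\<close>

lemma base_sum:
  "sum s UB + sum s {i\<in>V. s z < y i + s i} + sum s {i\<in>W. y i = s z} = 1"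
proof -
  let ?V = "{i\<in>V. s z < y i + s i}" and ?W = "{i\<in>W. y i = s z}"
  have "{i\<in>I. y i \<le> s z \<and> s z < y i + s i} = (UB \<union> ?V) \<union> ?W"
  proof (rule set_eqI)
    fix i
    have "s z \<le> x i \<or> s z \<le> y i" if "i \<in> I" "s z < y i + s i"
      using outside[OF that(1)] that z(3) by (cases "i = z") auto
    then show "i \<in> {i\<in>I. y i \<le> s z \<and> s z < y i + s i} \<longleftrightarrow> i \<in> (UB \<union> ?V) \<union> ?W"
      using pos[of i] unfolding UB_def V_def U_def W_def by force
  qed
  moreover have "UB \<inter> ?V = {}" "(UB \<union> ?V) \<inter> ?W = {}" using disj by (auto simp: UB_def)
  ultimately show ?thesis
    using sum_crossing[of "s z"] z(4) w_pos finite_parts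
    by (simp add: sum.union_disjoint UB_def w_def)
qed

lemma UT_ge: "1 - w \<le> sum s UT"
proof -
  have "sum s WT \<le> 1 - s z"
  \<comment> \<open>The half-open convention does not count squares that end at a line, so the top
    side is treated as the bottom of the reflected tiling.\<close>
  proof (rule square_tiling.sum_crossing_le[OF flip_y, of _ 0])
    show "WT \<subseteq> I" using sub_I by (auto simp: WT_def)
    show "1 - y i - s i \<le> 0 \<and> 0 < 1 - y i - s i + s i" if "i \<in> WT" for i
      using that pos[of i] by (auto simp: WT_def W_def)
    show "s z \<le> x i \<and> x i + s i \<le> 1" if "i \<in> WT" for i
      using that bounds[of i] by (auto simp: WT_def W_def)
  qed (use w_pos in \<open>simp add: w_def\<close>)
  then show ?thesis using top_sum by (simp add: w_def)
qed

text \<open>On the line through the upper side of \<open>z\<close>, all squares outside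
  \<open>UB\<close> lie to the right of \<open>x = s z\<close>, where only length \<open>w\<close>
  is available.\<close>

lemma UB_ge: "1 - w \<le> sum s UB"
proof -
  let ?V = "{i\<in>V. s z < y i + s i}" and ?W = "{i\<in>W. y i = s z}"
  have "sum s (?V \<union> ?W) \<le> 1 - s z"
  proof (rule sum_crossing_le[of _ "s z"])
    show "?V \<union> ?W \<subseteq> I" using sub_I by auto
    show "y i \<le> s z \<and> s z < y i + s i" if "i \<in> ?V \<union> ?W" for i
      using that pos[of i] by (auto simp: V_def W_def)
    show "s z \<le> x i \<and> x i + s i \<le> 1" if "i \<in> ?V \<union> ?W" for i
      using that bounds[of i] by (auto simp: V_def W_def)
  qed (use w_pos in \<open>simp add: w_def\<close>)
  moreover have "?V \<inter> ?W = {}" using disj by auto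
  ultimately show ?thesis
    using base_sum finite_parts by (simp add: sum.union_disjoint w_def)
qed

lemma UT_subset: "UT \<subseteq> U" and UB_subset: "UB \<subseteq> U" and UF_subset: "UF \<subseteq> U"
  by (auto simp: UT_def UB_def UF_def)

lemma finite_sub: "finite UT" "finite UB" "finite UF"
  using finite_subset finite_parts(1) UT_subset UB_subset UF_subset by blast+

lemma UF_eq: "UT \<inter> UB = UF"
proof (rule set_eqI)
  fix i
  show "i \<in> UT \<inter> UB \<longleftrightarrow> i \<in> UF"
    using bounds[of i] by (auto simp: UT_def UB_def UF_def U_def w_def)
qed

text \<open>Sides at most \<open>w\<close> must add up to at least \<open>1 - w\<close>. This
  exceeds \<open>w\<close> because \<open>w < 1/2\<close>, and exceeds \<open>2 * w\<close> when
  \<open>w < 1/3\<close>.\<close>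

lemma cards_ge: "2 \<le> card UT" "2 \<le> card UB"
  and cards_ge_thin: "w < 1/3 \<Longrightarrow> 3 \<le> card UT" "w < 1/3 \<Longrightarrow> 3 \<le> card UB"
proof -
  have *: "sum s A \<le> real (card A) * w" if "A \<subseteq> U" for A
    using that U_le_w by (intro sum_bounded_above) auto
  have **: "2 \<le> card A \<and> (w < 1/3 \<longrightarrow> 3 \<le> card A)" if A: "A \<subseteq> U" "1 - w \<le> sum s A" for A
  proof -
    have le: "1 - w \<le> real (card A) * w" using *[OF A(1)] A(2) by simp
    have "real (card A) * w \<le> 1 * w" if "card A \<le> 1"
      using that w_pos by (intro mult_right_mono) auto
    moreover have "real (card A) * w \<le> 2 * w" if "card A \<le> 2"
      using that w_pos by (intro mult_right_mono) auto
    ultimately show ?thesis using le w_lt by force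
  qed
  show "2 \<le> card UT" "2 \<le> card UB" "w < 1/3 \<Longrightarrow> 3 \<le> card UT" "w < 1/3 \<Longrightarrow> 3 \<le> card UB"
    using **[OF UT_subset UT_ge] **[OF UB_subset UB_ge] by auto
qed

text \<open>Inclusion-exclusion, since the squares spanning the strip above \<open>z\<close> are the
  full ones. Together with \<open>cards_ge\<close> it forces full squares whenever \<open>U\<close>
  is small.\<close>

lemma card_UT_UB: "card UT + card UB \<le> card U + card UF"
proof -
  have "card UT + card UB = card (UT \<union> UB) + card UF"
    using card_Un_Int[OF finite_sub(1,2)] UF_eq by simp
  also have "card (UT \<union> UB) \<le> card U"
    using UT_subset UB_subset finite_parts by (intro card_mono) auto
  finally show ?thesis by simp
qed

lemma WT_subset: "WT \<subseteq> W" by (auto simp: WT_def)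

lemma top_right_corner: "\<exists>c. WT \<inter> WR = {c}"
proof -
  have "square_tiling I (\<lambda>i. 1 - x i - s i) (\<lambda>i. 1 - y i - s i) s"
    by (rule square_tiling.flip_y[OF flip_x])
  from square_tiling.bottom_left_corner[OF this]
  obtain c where c: "c \<in> I" "x c + s c = 1" "y c + s c = 1" by auto
  have cz: "c \<noteq> z" using c z w_pos by (auto simp: w_def)
  have "c \<in> W" using c le_w[OF c(1) cz] by (auto simp: W_def w_def)
  then have "c \<in> WT \<inter> WR" using c by (auto simp: WT_def WR_def)
  moreover have "d = c" if "d \<in> WT \<inter> WR" for d
  proof (rule ccontr)
    have d: "d \<in> I" "x d + s d = 1" "y d + s d = 1"
      using that sub_I by (auto simp: WT_def WR_def)
    assume "d \<noteq> c"
    with sep[of d c] c d pos[of c] pos[of d] show False by auto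
  qed
  ultimately show ?thesis by blast
qed

text \<open>Sum \<open>s i * (w - s i)\<close> over the seven squares other than \<open>z\<close>:
  the area makes this sum an affine function of the total side, \<open>sum_mult_diff_le\<close>
  bounds it, and a factor \<open>w\<close> cancels.\<close>

lemma sum_bound: "sum s I \<le> 3 - 2 * w + (7 - (real (card UF) + real (card VF) + real (card WF))) * w / 4"
proof -
  let ?R = "U \<union> V \<union> W" and ?F = "UF \<union> VF \<union> WF"
  have R: "I - {z} = ?R" using partition not_z by auto
  have VF: "VF \<subseteq> V" by (rule big_corner.UF_subset[OF swap_big])
  have WF: "WF \<subseteq> W" by (auto simp: WF_def)
  have F: "?F \<subseteq> ?R" using UF_subset VF WF by blast
  have fR: "finite ?R" using finite_parts by simp
  have fF: "finite UF" "finite VF" "finite WF" using finite_subset UF_subset VF WF finite_parts by blast+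
  have sF: "s i = w" if "i \<in> ?F" for i
    using that by (auto simp: UF_def WF_def big_corner.UF_def[OF swap_big])
  have cF: "card ?F = card UF + card VF + card WF"
  proof -
    have "UF \<inter> VF = {}" "(UF \<union> VF) \<inter> WF = {}" using UF_subset VF WF disj by blast+
    then show ?thesis using fF by (simp add: card_Un_disjoint)
  qed
  have cR: "card ?R = 7" using card_I z(1) by (simp add: R[symmetric] card_Diff_singleton)
  have "(\<Sum>i\<in>?R. s i * (w - s i)) \<le> real (card (?R - ?F)) * (w\<^sup>2 / 4)"
    by (rule sum_mult_diff_le[OF fR F sF])
  also have "real (card (?R - ?F)) = 7 - (real (card UF) + real (card VF) + real (card WF))"
  proof -
    have "card (?R - ?F) = 7 - card ?F"
      unfolding cR[symmetric] using fF by (intro card_Diff_subset F) simp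
    moreover have "card ?F \<le> 7" using card_mono[OF fR F] unfolding cR .
    ultimately show ?thesis unfolding cF by linarith
  qed
  finally have le: "(\<Sum>i\<in>?R. s i * (w - s i)) \<le>
      (7 - (real (card UF) + real (card VF) + real (card WF))) * (w\<^sup>2 / 4)" by simp
  have "(\<Sum>i\<in>?R. s i * (w - s i)) = w * sum s ?R - (\<Sum>i\<in>?R. (s i)\<^sup>2)"
    by (simp add: right_diff_distrib sum_subtractf sum_distrib_left power2_eq_square mult.commute)
  also have "sum s ?R = sum s I - s z"
    unfolding R[symmetric] using fin z(1) by (simp add: sum_diff1)
  also have "(\<Sum>i\<in>?R. (s i)\<^sup>2) = 1 - (s z)\<^sup>2"
    unfolding R[symmetric] using fin z(1) area by (simp add: sum_diff1)
  \<comment> \<open>With \<open>s z = 1 - w\<close> the other squares have area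
    \<open>2 * w - w\<^sup>2\<close>, so \<open>w\<close> factors out.\<close>
  also have "w * (sum s I - s z) - (1 - (s z)\<^sup>2) = w * (sum s I - 3 + 2 * w)"
    by (simp add: w_def power2_eq_square algebra_simps)
  finally have "w * (sum s I - 3 + 2 * w) =
      (\<Sum>i\<in>?R. s i * (w - s i))" by (rule sym)
  also note le
  also have "n * (w\<^sup>2 / 4) = w * (n * w / 4)" for n
    by (simp add: power2_eq_square)
  finally have "w * (sum s I - 3 + 2 * w) \<le> w * ((7 - (real (card UF) + real (card VF) + real (card WF))) * w / 4)" .
  then show ?thesis using w_pos by simp
qed

text \<open>Two squares violating both alternatives would overlap just above and to the right of the
  corner \<open>(s z, s z)\<close>.\<close>

lemma corner_covered_once:
  "(\<forall>i\<in>VB. y i + s i \<le> s z) \<or> (\<forall>i\<in>UB. x i + s i \<le> s z)"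
proof (rule ccontr)
  assume "\<not> ?thesis"
  then obtain i j where ij: "i \<in> VB" "s z < y i + s i" "j \<in> UB" "s z < x j + s j" by force
  then have "i \<in> I" "j \<in> I" "i \<noteq> j" "x i = s z" "y i < s z" "y j = s z" "x j < s z"
    by (auto simp: UB_def U_def big_corner.UB_def[OF swap_big] V_def)
  with ij sep[of i j] pos[of i] pos[of j] show False by auto
qed

end

section \<open>Distributions of the other seven squares with few full ones\<close>

lemma card_1_obtain:
  assumes "card A = Suc 0" obtains a where "A = {a}"
  using assms by (auto simp: card_Suc_eq)

lemma card_insert_obtain:
  assumes "finite A" "a \<in> A" "card A = Suc n"
  obtains B where "A = insert a B" "a \<notin> B" "card B = n" "finite B"
  using assms by (metis card_Suc_Diff1 finite_Diff insert_Diff Diff_iff insertI1 nat.inject)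

text \<open>Used with \<open>A = UT\<close> and \<open>B = UB\<close>: \<open>f\<close> is the full
  square, \<open>p\<close> only touches the top and \<open>q\<close> only rests on
  \<open>z\<close>.\<close>

lemma three_two_two:
  assumes "finite U" "A \<subseteq> U" "B \<subseteq> U" "card U = 3" "2 \<le> card A" "2 \<le> card B" "card (A \<inter> B) = 1"
  obtains f p q where "U = {f, p, q}" "A = {f, p}" "B = {f, q}" "f \<noteq> p" "f \<noteq> q" "p \<noteq> q"
proof -
  have fin: "finite A" "finite B" using assms finite_subset by blast+
  have "card A + card B = card (A \<union> B) + 1"
    using card_Un_Int[OF fin] assms(7) by simp
  moreover have "card (A \<union> B) \<le> 3"
    using card_mono[of U "A \<union> B"] assms by simp
  ultimately have c: "card A = Suc (Suc 0)" "card B = Suc (Suc 0)" using assms by auto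
  obtain f where f: "A \<inter> B = {f}" using assms(7) card_1_obtain by auto
  obtain A' where A': "A = insert f A'" "f \<notin> A'" "card A' = Suc 0"
    using card_insert_obtain[OF fin(1) _ c(1), of f] f by blast
  obtain B' where B': "B = insert f B'" "f \<notin> B'" "card B' = Suc 0"
    using card_insert_obtain[OF fin(2) _ c(2), of f] f by blast
  obtain p where p: "A' = {p}" using A'(3) card_1_obtain by blast
  obtain q where q: "B' = {q}" using B'(3) card_1_obtain by blast
  have ne: "f \<noteq> p" "f \<noteq> q" "p \<noteq> q" using A' B' p q f by auto
  have "{f, p, q} = U"
    using ne assms A' B' p q by (intro card_subset_eq) auto
  then show ?thesis using that[of f p q] ne A' B' p q by simp
qed

lemma four_three_two:
  assumes "finite U" "A \<subseteq> U" "B \<subseteq> U" "card U = 4" "card A = 3" "card B = 2" "card (A \<inter> B) = 1"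
  obtains f p q r where "U = {f, p, q, r}" "A = {f, p, q}" "B = {f, r}"
    "f \<notin> {p, q, r}" "p \<notin> {q, r}" "q \<noteq> r"
proof -
  have fin: "finite A" "finite B" using assms finite_subset by blast+
  obtain f where f: "A \<inter> B = {f}" using assms(7) card_1_obtain by auto
  obtain A' where A': "A = insert f A'" "f \<notin> A'" "card A' = 2"
    using card_insert_obtain[OF fin(1), of f 2] f assms(5) by auto
  obtain B' where B': "B = insert f B'" "f \<notin> B'" "card B' = Suc 0"
    using card_insert_obtain[OF fin(2), of f 1] f assms(6) by auto
  obtain p q where p: "A' = {p, q}" "p \<noteq> q" using A'(3) by (auto simp: card_2_iff)
  obtain r where r: "B' = {r}" using B'(3) card_1_obtain by blast
  have ne: "f \<notin> {p, q, r}" "p \<notin> {q, r}" "q \<noteq> r" using A' B' p r f by auto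
  have "{f, p, q, r} = U"
    using ne assms A' B' p r by (intro card_subset_eq) auto
  then show ?thesis using that[of f p q r] ne A' B' p r by simp
qed

text \<open>Replacing \<open>r\<close> by its lower bound can only decrease the area, and twice the
  excess of the result over 1 is \<open>(5 * w - 2)\<^sup>2 + (p - q)\<^sup>2\<close>. Hence the
  area condition even forces \<open>w = 2/5\<close>.\<close>

lemma two_fifths_aux:
  fixes w p q r c :: real
  assumes "w < 1/2" "p + q = w" "1 - 2 * w \<le> r"
    and "(1 - w)\<^sup>2 + 3 * w\<^sup>2 + (1 - 2 * w)\<^sup>2 + p\<^sup>2 + q\<^sup>2 + r\<^sup>2 = 1"
  shows "2/5 \<le> w"
proof -
  have "(1 - 2 * w)\<^sup>2 \<le> r\<^sup>2" using assms by (intro power_mono) auto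
  moreover define X where "X = (1 - w)\<^sup>2 + 3 * w\<^sup>2 + 2 * (1 - 2 * w)\<^sup>2 + p\<^sup>2 + q\<^sup>2"
  ultimately have "2 * (X - 1) \<le> 0" using assms(4) by simp
  also have "2 * (X - 1) = (5 * w - 2)\<^sup>2 + (p - q)\<^sup>2"
    unfolding X_def assms(2)[symmetric] by (simp add: power2_eq_square algebra_simps)
  finally have "(5 * w - 2)\<^sup>2 + (p - q)\<^sup>2 \<le> 0" .
  then have "5 * w - 2 = 0" by (simp add: sum_power2_le_zero_iff)
  then show ?thesis by simp
qed

context big_corner
begin

lemma UF_sum: "sum s UF = real (card UF) * w" "(\<Sum>i\<in>UF. (s i)\<^sup>2) = real (card UF) * w\<^sup>2"
  by (simp_all add: UF_def)

lemma U_lt_w: "i \<in> U \<Longrightarrow> i \<notin> UF \<Longrightarrow> s i < w"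
  using U_le_w[of i] by (auto simp: UF_def)

lemma U_card_3:
  assumes "card U = 3" "card UF = 1"
  obtains f p q where "U = {f, p, q}" "UT = {f, p}" "UB = {f, q}" "f \<noteq> p" "f \<noteq> q" "p \<noteq> q"
    "s f = w" "s p < w" "1 - 2 * w \<le> s q"
proof -
  have "card (UT \<inter> UB) = 1" using assms UF_eq by simp
  from three_two_two[OF finite_parts(1) UT_subset UB_subset assms(1) cards_ge this]
  obtain f p q where *: "U = {f, p, q}" "UT = {f, p}" "UB = {f, q}" "f \<noteq> p" "f \<noteq> q" "p \<noteq> q" .
  then have F: "UF = {f}" using UF_eq by auto
  then have "s f = w" by (auto simp: UF_def)
  moreover have "s p < w" using U_lt_w[of p] * F by auto
  moreover have "1 - 2 * w \<le> s q" using UB_ge * \<open>s f = w\<close> by simp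
  ultimately show ?thesis using that * by blast
qed

text \<open>Both \<open>UT\<close> and \<open>UB\<close> need two squares, so with only two
  available each square lies in both and is full.\<close>

lemma U_card_2:
  assumes "card U = 2"
  shows "UF = U" "UT = U"
proof -
  show "UF = U"
    using card_UT_UB cards_ge assms finite_parts by (intro card_seteq UF_subset) auto
  then show "UT = U" using UF_eq UT_subset by auto
qed

lemma W_singleton:
  assumes "card W = 1"
  obtains c where "W = {c}" "WT = {c}" "WR = {c}"
proof -
  obtain c where c: "WT \<inter> WR = {c}" using top_right_corner by blast
  obtain c' where c': "W = {c'}" using assms card_1_obtain by auto
  have "c \<in> WT" "c \<in> WR" using c by auto
  then have "W = {c}" "WT = {c}" "WR = {c}" using c' by (auto simp: WT_def WR_def)
  then show ?thesis by (rule that)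
qed

lemmas VF_sum = big_corner.UF_sum[OF swap_big]

text \<open>The two squares of \<open>V\<close> are full, which leaves \<open>1 - 2 * w\<close> of
  the right side to \<open>W\<close>. Comparing the right side with the top determines how the two
  squares of \<open>W\<close> lie, and then the area fixes \<open>w\<close> through
  \<open>two_fifths_aux\<close>.\<close>

lemma case_322:
  assumes "card U = 3" "card V = 2" "card W = 2" "card UF = 1" "card WF = 0"
  shows "2/5 \<le> w"
proof -
  obtain f p q where U: "U = {f, p, q}" "UT = {f, p}" "UB = {f, q}" "f \<noteq> p" "f \<noteq> q" "p \<noteq> q"
    "s f = w" "s p < w" "1 - 2 * w \<le> s q"
    using U_card_3 assms by blast
  have VF: "VF = V" "VT = V" using big_corner.U_card_2[OF swap_big] assms by auto
  then have V: "sum s VT = 2 * w" "(\<Sum>i\<in>V. (s i)\<^sup>2) = 2 * w\<^sup>2"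
    using VF_sum assms by simp_all
  have WR: "sum s WR = 1 - 2 * w"
    using big_corner.top_sum[OF swap_big] V by simp
  have WT: "w + s p + sum s WT = 1" using top_sum U by simp
  obtain c where c: "WT \<inter> WR = {c}" using top_right_corner by blast
  have sub: "WT \<subseteq> W" "WR \<subseteq> W" by (auto simp: WT_def WR_def)
  obtain D where D: "W = insert c D" "c \<notin> D" "card D = Suc 0"
  proof (rule card_insert_obtain[OF finite_parts(3)])
    show "c \<in> W" using c sub by blast
    show "card W = Suc (Suc 0)" using assms(3) by simp
  qed
  then obtain d where d: "D = {d}" using card_1_obtain by blast
  have "WF = {}" using assms(5) finite_parts by (simp add: WF_def)
  then have lt: "s c < w" "s d < w" and pos: "0 < s d"
    using W_le_w[of c] W_le_w[of d] D d pos[of d] sub_I by (auto simp: WF_def)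
  have area': "(1 - w)\<^sup>2 + 3 * w\<^sup>2 + (s p)\<^sup>2 + (s q)\<^sup>2 + (s c)\<^sup>2 + (s d)\<^sup>2 = 1"
    using sum_partition[of "\<lambda>i. (s i)\<^sup>2"] area U V(2) D d by (simp add: w_def)
  \<comment> \<open>If \<open>WT = {c}\<close>, the top sum and \<open>s p < w\<close> give
    \<open>s c > 1 - 2 * w\<close>, but \<open>c\<close> also belongs to \<open>WR\<close>, whose
    total side is \<open>1 - 2 * w\<close>. Only the third case survives.\<close>
  consider "WT = {c}" "WR = {c}" | "WT = {c}" "WR = {c, d}" | "WT = {c, d}" "WR = {c}"
    using c sub D d by blast
  then show ?thesis
  proof cases
    case 3
    then have e: "s c = 1 - 2 * w" "s p + s d = w" using WR WT D d by auto
    show ?thesis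
      by (rule two_fifths_aux[OF w_lt e(2) U(9)]) (use area' e(1) in simp)
  qed (use WR WT D d U(8) pos in auto)
qed

text \<open>Again \<open>V\<close> is full, so the corner square has side \<open>1 - 2 * w\<close>
  and \<open>UT\<close> has total side \<open>2 * w\<close>. This determines all cardinalities and
  leads to the area equation of \<open>two_fifths_aux\<close>.\<close>

lemma case_421:
  assumes "card U = 4" "card V = 2" "card W = 1" "card UF \<le> 1"
  shows "2/5 \<le> w \<and> card UF = 1"
proof -
  have VF: "VF = V" "VT = V" using big_corner.U_card_2[OF swap_big] assms by auto
  then have V: "sum s VT = 2 * w" "(\<Sum>i\<in>V. (s i)\<^sup>2) = 2 * w\<^sup>2"
    using VF_sum assms by simp_all
  obtain c where W: "W = {c}" "WT = {c}" "WR = {c}"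
    using W_singleton[OF assms(3)] .
  have sc: "s c = 1 - 2 * w"
    using big_corner.top_sum[OF swap_big] V W by simp
  have UT: "sum s UT = 2 * w" using top_sum W sc by simp
  \<comment> \<open>Two squares with total side \<open>2 * w\<close> and sides at most
    \<open>w\<close> would both be full, but at most one square of \<open>U\<close> is.\<close>
  have "card UT \<noteq> 2"
  proof
    assume 2: "card UT = 2"
    have "(\<Sum>i\<in>UT. w - s i) = 0" using 2 UT by (simp add: sum_subtractf)
    then have "\<forall>i\<in>UT. w - s i = 0"
      using U_le_w UT_subset finite_sub by (subst (asm) sum_nonneg_eq_0_iff) auto
    then have "UT \<subseteq> UF" using UT_subset by (auto simp: UF_def)
    then have "2 \<le> card UF" using card_mono[OF finite_sub(3)] 2 by metis
    then show False using assms by simp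
  qed
  then have cards: "card UT = 3" "card UB = 2" "card UF = 1"
    using cards_ge card_UT_UB assms by auto
  then have "card (UT \<inter> UB) = 1" using UF_eq by simp
  from four_three_two[OF finite_parts(1) UT_subset UB_subset assms(1) cards(1,2) this]
  obtain f p q r where U: "U = {f, p, q, r}" "UT = {f, p, q}" "UB = {f, r}"
    "f \<notin> {p, q, r}" "p \<notin> {q, r}" "q \<noteq> r" .
  then have "UF = {f}" using UF_eq by auto
  then have f: "s f = w" by (auto simp: UF_def)
  have pq: "s p + s q = w" using UT U f by simp
  have r: "1 - 2 * w \<le> s r" using UB_ge U f by simp
  have "(1 - w)\<^sup>2 + 3 * w\<^sup>2 + (1 - 2 * w)\<^sup>2 + (s p)\<^sup>2 + (s q)\<^sup>2 + (s r)\<^sup>2 = 1"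
    using sum_partition[of "\<lambda>i. (s i)\<^sup>2"] area U f V(2) W sc by (simp add: w_def)
  from two_fifths_aux[OF w_lt pq r this] cards show ?thesis by simp
qed

text \<open>After replacing \<open>u\<close> and \<open>v\<close> by their lower bounds, the excess
  over 1 is \<open>(2 * c - (1 - w))\<^sup>2 + 2 * (1 - 2 * w)\<^sup>2\<close>, positive because
  \<open>w < 1/2\<close>. This refutes the 3-3-1 distribution with a corner square that is not
  full.\<close>

lemma area_331_pos:
  fixes c u v :: real
  assumes "0 < c" "c \<le> u" "1 - 2 * w \<le> v"
  shows "1 < (1 - w)\<^sup>2 + 2 * w\<^sup>2 + 2 * (1 - w - c)\<^sup>2 + u\<^sup>2 + v\<^sup>2 + c\<^sup>2"
proof -
  have "c\<^sup>2 \<le> u\<^sup>2" "(1 - 2 * w)\<^sup>2 \<le> v\<^sup>2"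
    using assms w_lt by (auto intro!: power_mono)
  moreover have "(1 - w)\<^sup>2 + 2 * w\<^sup>2 + 2 * (1 - w - c)\<^sup>2 + c\<^sup>2 + (1 - 2 * w)\<^sup>2 + c\<^sup>2
      = 1 + ((2 * c - (1 - w))\<^sup>2 + 2 * (1 - 2 * w)\<^sup>2)"
    by (simp add: power2_eq_square algebra_simps)
  moreover have "0 < (2 * c - (1 - w))\<^sup>2 + 2 * (1 - 2 * w)\<^sup>2"
    using w_lt by (intro add_nonneg_pos) auto
  ultimately show ?thesis by linarith
qed

text \<open>Compare the top or right side, where \<open>w + s p + s c = 1\<close>, with the line
  along the upper side of \<open>z\<close>. On that line \<open>c\<close> is absent because it is
  too small to reach down to it, and of \<open>V\<close> only \<open>p\<close> can cross, so
  \<open>q\<close> must make up for \<open>s c\<close>.\<close>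

lemma case_331_base:
  assumes "W = {c}" "s c < w" "UB = {f, q}" "f \<noteq> q" "s f = w" "V = {g, p, r}" "VB = {g, r}"
    "w + s p + s c = 1" "\<forall>i\<in>VB. y i + s i \<le> s z"
  shows "s c \<le> s q"
proof -
  have "sum s {i\<in>W. y i = s z} = 0"
  proof (rule sum.neutral)
    have "y c + s c = 1"
      using top_right_corner assms(1) by (auto simp: WT_def)
    then show "\<forall>i\<in>{i\<in>W. y i = s z}. s i = 0" using assms(1,2) by (auto simp: w_def)
  qed
  moreover have "sum s {i\<in>V. s z < y i + s i} \<le> s p"
  proof -
    have "p \<in> I" using assms(6) sub_I by auto
    then have "sum s {i\<in>V. s z < y i + s i} \<le> sum s {p}"
      using assms(6,7,9) pos by (intro sum_mono2) (auto simp: less_imp_le)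
    then show ?thesis by simp
  qed
  ultimately show ?thesis using base_sum assms(3,4,5,8) by simp
qed

text \<open>\<open>U\<close> and \<open>V\<close> each contain a full square. Two in one and one in
  the other is inconsistent along the top and right sides. With one in each, a full corner square
  gives \<open>2/5 \<le> w\<close> by the area; otherwise \<open>corner_covered_once\<close> makes a
  base square at least as large as the corner square, against \<open>area_331_pos\<close>.\<close>

lemma case_331:
  assumes "card U = 3" "card V = 3" "card W = 1" "card UF + card VF + card WF \<le> 3"
  shows "2/5 \<le> w \<and> card UF + card VF + card WF = 3"
proof -
  have ge: "1 \<le> card UF" "1 \<le> card VF"
    using card_UT_UB cards_ge assms big_corner.card_UT_UB[OF swap_big]
      big_corner.cards_ge[OF swap_big] by auto
  obtain c where W: "W = {c}" "WT = {c}" "WR = {c}"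
    using W_singleton[OF assms(3)] .
  have c0: "0 < s c" using W sub_I pos by auto
  have WF: "WF = (if s c = w then {c} else {})" using W by (auto simp: WF_def)
  have T: "sum s UT + s c = 1" "sum s VT + s c = 1"
    using top_sum big_corner.top_sum[OF swap_big] W by simp_all
  \<comment> \<open>Two full squares on one side give \<open>s c \<le> 1 - 2 * w\<close>; on the
    other side, one full square together with \<open>p < w\<close> gives
    \<open>s c > 1 - 2 * w\<close>.\<close>
  have mixed: False
    if "card A = 2" "A \<subseteq> B" "finite B" "\<forall>i\<in>A. s i = w" "\<forall>i\<in>B. 0 < s i" "sum s B + s c = 1"
      "w + p + s c = 1" "p < w" for A B p
  proof -
    have "sum s A \<le> sum s B" using that by (intro sum_mono2) (auto simp: less_imp_le)
    moreover have "sum s A = 2 * w" using that by simp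
    ultimately show False using that by simp
  qed
  consider "card UF = 1" "card VF = 1" | "card UF = 2" "card VF = 1" | "card UF = 1" "card VF = 2"
    using ge assms(4) by linarith
  then show ?thesis
  proof cases
    case 2
    obtain f p q where V: "V = {f, p, q}" "VT = {f, p}" "VB = {f, q}" "f \<noteq> p" "f \<noteq> q" "p \<noteq> q"
      "s f = w" "s p < w" "1 - 2 * w \<le> s q"
      using big_corner.U_card_3[OF swap_big assms(2) 2(2)] by blast
    have "UF \<subseteq> UT" using UF_eq by blast
    moreover have "\<forall>i\<in>UT. 0 < s i"
      using UT_subset sub_I pos by blast
    moreover have "\<forall>i\<in>UF. s i = w" by (simp add: UF_def)
    moreover have "w + s p + s c = 1" using T V by simp
    ultimately show ?thesis
      using mixed[of UF UT "s p"] 2(1) T(1) V(8) finite_sub(1) by simp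
  next
    case 3
    obtain f p q where U: "U = {f, p, q}" "UT = {f, p}" "UB = {f, q}" "f \<noteq> p" "f \<noteq> q" "p \<noteq> q"
      "s f = w" "s p < w" "1 - 2 * w \<le> s q"
      using U_card_3[OF assms(1) 3(1)] by blast
    have "VF \<subseteq> VT" using big_corner.UF_eq[OF swap_big] by blast
    moreover have "\<forall>i\<in>VT. 0 < s i"
      using big_corner.UT_subset[OF swap_big] sub_I pos by blast
    moreover have "\<forall>i\<in>VF. s i = w" by (simp add: big_corner.UF_def[OF swap_big])
    moreover have "w + s p + s c = 1" using T U by simp
    ultimately show ?thesis
      using mixed[of VF VT "s p"] 3(2) T(2) U(8) big_corner.finite_sub(1)[OF swap_big] by simp
  next
    case 1
    obtain f p q where U: "U = {f, p, q}" "UT = {f, p}" "UB = {f, q}" "f \<noteq> p" "f \<noteq> q" "p \<noteq> q"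
      "s f = w" "s p < w" "1 - 2 * w \<le> s q"
      using U_card_3[OF assms(1) 1(1)] by blast
    obtain g p' q' where V: "V = {g, p', q'}" "VT = {g, p'}" "VB = {g, q'}" "g \<noteq> p'" "g \<noteq> q'" "p' \<noteq> q'"
      "s g = w" "s p' < w" "1 - 2 * w \<le> s q'"
      using big_corner.U_card_3[OF swap_big assms(2) 1(2)] by blast
    have p: "s p = 1 - w - s c" "s p' = 1 - w - s c" using T U V by simp_all
    have area': "(1 - w)\<^sup>2 + 2 * w\<^sup>2 + 2 * (1 - w - s c)\<^sup>2 + (s q)\<^sup>2 + (s q')\<^sup>2 + (s c)\<^sup>2 = 1"
      using sum_partition[of "\<lambda>i. (s i)\<^sup>2"] area U V W p by (simp add: w_def)
    show ?thesis
    proof (cases "s c = w")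
      case True
      have "(1 - 2 * w)\<^sup>2 \<le> (s q)\<^sup>2" "(1 - 2 * w)\<^sup>2 \<le> (s q')\<^sup>2"
        using U V w_lt by (auto intro!: power_mono)
      then have "(1 - w)\<^sup>2 + 2 * w\<^sup>2 + 2 * (1 - 2 * w)\<^sup>2 + 2 * (1 - 2 * w)\<^sup>2 + w\<^sup>2 \<le> 1"
        using area' True by simp
      moreover have "(1 - w)\<^sup>2 + 2 * w\<^sup>2 + 2 * (1 - 2 * w)\<^sup>2 + 2 * (1 - 2 * w)\<^sup>2 + w\<^sup>2
          = 1 + 2 * ((1 - 2 * w) * (2 - 5 * w))"
        by (simp add: power2_eq_square algebra_simps)
      ultimately have "(1 - 2 * w) * (2 - 5 * w) \<le> 0" by linarith
      then have "2 - 5 * w \<le> 0" using w_lt by (simp add: mult_le_0_iff)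
      then show ?thesis using 1 WF True by simp
    next
      case False
      then have c: "s c < w" using W_le_w[of c] W by simp
      have Wc: "big_corner.W I y x s z = {c}" using W_swap W by simp
      have "s c \<le> s q \<or> s c \<le> s q'"
        using corner_covered_once
      proof
        assume H: "\<forall>i\<in>VB. y i + s i \<le> s z"
        have "w + s p' + s c = 1" using p by simp
        from case_331_base[OF W(1) c U(3,5,7) V(1,3) this H] show ?thesis ..
      next
        assume H: "\<forall>i\<in>UB. x i + s i \<le> s z"
        have "w + s p + s c = 1" using p by simp
        from big_corner.case_331_base[OF swap_big Wc c V(3,5,7) U(1,3) this H] show ?thesis ..
      qed
      then show ?thesis
      proof
        assume "s c \<le> s q"
        from area_331_pos[OF c0 this V(9)] area' show ?thesis by simp
      next
        assume "s c \<le> s q'"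
        from area_331_pos[OF c0 this U(9)] area' show ?thesis by simp
      qed
    qed
  qed
qed

section \<open>The bound 13/5 for tilings with a big corner square\<close>

lemma sum_bound_full:
  assumes "n \<le> card UF + card VF + card WF"
  shows "sum s I \<le> 3 - 2 * w + (7 - real n) * w / 4"
proof -
  have "(7 - (real (card UF) + real (card VF) + real (card WF))) * w / 4 \<le> (7 - real n) * w / 4"
    using assms w_pos by (intro divide_right_mono mult_right_mono) auto
  then show ?thesis using sum_bound by linarith
qed

lemma big_corner_bound_aux:
  assumes "card V \<le> card U"
  shows "sum s I \<le> 13/5"
proof (cases "w < 1/3")
  case True
  have "3 \<le> card UT" "3 \<le> card UB" "3 \<le> card VT" "3 \<le> card VB"
    using cards_ge_thin big_corner.cards_ge_thin[OF swap_big] True by simp_all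
  moreover have "card UT \<le> card U" "card VT \<le> card V"
    using card_mono[OF finite_parts(1) UT_subset]
      card_mono[OF finite_parts(2) big_corner.UT_subset[OF swap_big]] by simp_all
  moreover have "1 \<le> card W"
    using top_right_corner WT_subset finite_parts(3) by (metis Int_lower1 One_nat_def Suc_leI card_gt_0_iff equals0D insertI1 subset_iff)
  \<comment> \<open>Seven squares with at least 3, 3 and 1 in the parts leave no freedom, so all
    squares of \<open>U\<close> and \<open>V\<close> are full.\<close>
  ultimately have "6 \<le> card UF + card VF + card WF"
    using card_partition card_UT_UB big_corner.card_UT_UB[OF swap_big] by linarith
  then have "sum s I \<le> 3 - 2 * w + w / 4"
    using sum_bound_full[of 6] by simp
  \<comment> \<open>The seven other squares cover area \<open>1 - (1 - w)\<^sup>2\<close> with at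
    most \<open>w\<^sup>2\<close> each.\<close>
  moreover have "1/4 \<le> w"
  proof -
    have "(\<Sum>i\<in>I - {z}. (s i)\<^sup>2) \<le> real (card (I - {z})) * w\<^sup>2"
      using le_w pos by (intro sum_bounded_above power_mono) (auto simp: less_imp_le)
    moreover have "real (card (I - {z})) = 7" using card_I z(1) by (simp add: card_Diff_singleton)
    moreover have "(\<Sum>i\<in>I - {z}. (s i)\<^sup>2) = 1 - (1 - w)\<^sup>2"
      using fin z(1) area by (simp add: sum_diff1 w_def)
    ultimately have "w * 2 \<le> w * (8 * w)" by (simp add: power2_eq_square algebra_simps)
    then show ?thesis using w_pos by simp
  qed
  ultimately show ?thesis by linarith
next
  case False
  \<comment> \<open>Four full squares give \<open>3 - 5 * w / 4\<close>, enough for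
    \<open>w \<ge> 1/3\<close>. Three give \<open>3 - w\<close>, which is 13/5 exactly at
    \<open>w = 2/5\<close>.\<close>
  have *: ?thesis if "4 \<le> card UF + card VF + card WF"
    using sum_bound_full[OF that] False by simp
  have **: ?thesis if "3 \<le> card UF + card VF + card WF" "2/5 \<le> w"
    using sum_bound_full[OF that(1)] that(2) by simp
  have U: "4 \<le> card U + card UF" "4 \<le> card V + card VF"
    using cards_ge card_UT_UB big_corner.cards_ge[OF swap_big] big_corner.card_UT_UB[OF swap_big] by linarith+
  have "card UF \<le> card U" "card VF \<le> card V"
    using card_mono[OF finite_parts(1) UF_subset]
      card_mono[OF finite_parts(2) big_corner.UF_subset[OF swap_big]] by simp_all
  with U have V2: "2 \<le> card U" "2 \<le> card V" by linarith+
  have W: "1 \<le> card W"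
    using top_right_corner WT_subset finite_parts(3) by (metis Int_lower1 One_nat_def Suc_leI card_gt_0_iff equals0D insertI1 subset_iff)
  show ?thesis
  proof (cases "4 \<le> card UF + card VF + card WF")
    case 4: False
    \<comment> \<open>At most three full squares force \<open>card U + card V \<ge> 5\<close>, and
      the corner square in \<open>W\<close> forces it to be at most 6.\<close>
    then consider "card U = 3" "card V = 2" "card W = 2" | "card U = 4" "card V = 2" "card W = 1"
      | "card U = 3" "card V = 3" "card W = 1"
      using U V2 W assms card_partition by linarith
    then show ?thesis
    proof cases
      case 1
      then show ?thesis using case_322 U 4 ** by simp
    next
      case 2
      then show ?thesis using case_421 U 4 ** by simp
    next
      case 3
      then show ?thesis using case_331 U 4 ** by simp
    qed
  qed (rule *)
qed

lemma big_corner_bound: "sum s I \<le> 13/5"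
  using big_corner_bound_aux big_corner.big_corner_bound_aux[OF swap_big] by (rule linorder_le_cases) 

end

section \<open>Corner squares of side at most one half\<close>

text \<open>The squares \<open>a\<close>, \<open>b\<close>, \<open>c\<close>, \<open>d\<close> sit
  in the corners, counterclockwise from the bottom left; \<open>\<beta>\<close>,
  \<open>\<tau>\<close>, \<open>\<sigma>\<close>, \<open>\<rho>\<close> are the middle squares at
  the bottom, top, left and right. Lines missing two opposite middle squares are filled by two
  squares. This forces adjacent middle squares of side at least 1/2, which do not fit, or two
  opposite corner squares of side 1/2, which contradict the area.\<close>

lemma pinwheel_impossible:
  fixes a b c d \<beta> \<tau> \<sigma> \<rho> :: real
  assumes pos: "0 < a" "0 < b" "0 < c" "0 < d" "0 < \<beta>" "0 < \<tau>" "0 < \<sigma>" "0 < \<rho>"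
    and half: "a \<le> 1/2" "b \<le> 1/2" "c \<le> 1/2" "d \<le> 1/2"
    and sides: "a + b + \<beta> = 1" "d + c + \<tau> = 1" "a + d + \<sigma> = 1" "b + c + \<rho> = 1"
    and area: "a\<^sup>2 + b\<^sup>2 + c\<^sup>2 + d\<^sup>2 + \<beta>\<^sup>2 + \<tau>\<^sup>2 + \<sigma>\<^sup>2 + \<rho>\<^sup>2 = 1"
    and sep: "a + \<beta> + \<rho> \<le> 1 \<or> c + \<beta> + \<rho> \<le> 1" "b + \<rho> + \<tau> \<le> 1 \<or> d + \<rho> + \<tau> \<le> 1"
      "a + \<tau> + \<sigma> \<le> 1 \<or> c + \<tau> + \<sigma> \<le> 1" "b + \<sigma> + \<beta> \<le> 1 \<or> d + \<sigma> + \<beta> \<le> 1"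
    and horizontal: "\<beta> + \<tau> < 1 \<Longrightarrow> \<exists>l\<in>{a, \<sigma>, d}. \<exists>r\<in>{b, \<rho>, c}. l + r = 1"
    and vertical: "\<sigma> + \<rho> < 1 \<Longrightarrow> \<exists>l\<in>{a, \<beta>, b}. \<exists>r\<in>{d, \<tau>, c}. l + r = 1"
  shows False
proof -
  have eq: "\<sigma> + \<rho> = \<beta> + \<tau>" using sides by linarith
  have sq2: "(u + v)\<^sup>2 \<le> 2 * u\<^sup>2 + 2 * v\<^sup>2" for u v :: real
    using zero_le_power2[of "u - v"] by (simp add: power2_eq_square algebra_simps)
  \<comment> \<open>Otherwise the four middle squares alone would have area at least 1.\<close>
  have lt: "\<beta> + \<tau> < 1"
  proof (rule ccontr)
    assume "\<not> \<beta> + \<tau> < 1"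
    then have "1 \<le> (\<beta> + \<tau>)\<^sup>2" "1 \<le> (\<sigma> + \<rho>)\<^sup>2"
      using eq by (simp_all add: one_le_power)
    from order_trans[OF this(1) sq2] order_trans[OF this(2) sq2] have "1 \<le> \<beta>\<^sup>2 + \<tau>\<^sup>2 + \<sigma>\<^sup>2 + \<rho>\<^sup>2" by linarith
    moreover have "0 < a\<^sup>2" "0 \<le> b\<^sup>2" "0 \<le> c\<^sup>2" "0 \<le> d\<^sup>2" using pos by auto
    ultimately show False using area by linarith
  qed
  \<comment> \<open>Two corner squares on a common side cannot sum to 1 because of the middle square
    between them, and diagonal ones do so only if both are 1/2.\<close>
  have h: "1/2 \<le> \<sigma> \<or> 1/2 \<le> \<rho> \<or> (a = 1/2 \<and> c = 1/2) \<or> (b = 1/2 \<and> d = 1/2)"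
    using horizontal[OF lt] pos half sides eq lt by auto
  have v: "1/2 \<le> \<beta> \<or> 1/2 \<le> \<tau> \<or> (a = 1/2 \<and> c = 1/2) \<or> (b = 1/2 \<and> d = 1/2)"
    using vertical lt pos half sides eq by auto
  \<comment> \<open>With two opposite corner squares of side 1/2, the sides make the middle squares
    equal in pairs \<open>u\<close>, \<open>v\<close>, and the area becomes
    \<open>u * (3 * u - 1) + v * (3 * v - 1) = 0\<close> with both terms negative.\<close>
  have diag: False if "0 < u" "0 < v" "u \<le> 1/4" "v \<le> 1/4"
    "(1/2)\<^sup>2 + (1/2)\<^sup>2 + (1/2 - u)\<^sup>2 + (1/2 - v)\<^sup>2 + 2 * u\<^sup>2 + 2 * v\<^sup>2 = 1" for u v :: real
  proof -
    have "u * (3 * u - 1) < 0" "v * (3 * v - 1) < 0"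
      using that by (auto intro!: mult_pos_neg)
    moreover have "u * (3 * u - 1) + v * (3 * v - 1) = 0"
      using that(5) by (simp add: power2_eq_square algebra_simps)
    ultimately show False by linarith
  qed
  have "\<not> (1/2 \<le> \<beta> \<and> 1/2 \<le> \<rho>)" "\<not> (1/2 \<le> \<tau> \<and> 1/2 \<le> \<rho>)"
    "\<not> (1/2 \<le> \<tau> \<and> 1/2 \<le> \<sigma>)" "\<not> (1/2 \<le> \<beta> \<and> 1/2 \<le> \<sigma>)"
    using sep pos by auto
  with h v consider "a = 1/2" "c = 1/2" | "b = 1/2" "d = 1/2" by blast
  then show False
  proof cases
    case 1
    then have e: "b = 1/2 - \<beta>" "\<rho> = \<beta>" "d = 1/2 - \<tau>" "\<sigma> = \<tau>" using sides by auto
    have "\<beta> \<le> 1/4" "\<tau> \<le> 1/4" using sep unfolding 1 e by auto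
    moreover have "(1/2)\<^sup>2 + (1/2)\<^sup>2 + (1/2 - \<beta>)\<^sup>2 + (1/2 - \<tau>)\<^sup>2 + 2 * \<beta>\<^sup>2 + 2 * \<tau>\<^sup>2 = 1"
      using area unfolding 1 e by (simp add: power2_eq_square algebra_simps)
    ultimately show False using diag pos by blast
  next
    case 2
    then have e: "a = 1/2 - \<beta>" "\<sigma> = \<beta>" "c = 1/2 - \<tau>" "\<rho> = \<tau>" using sides by auto
    have "\<beta> \<le> 1/4" "\<tau> \<le> 1/4" using sep unfolding 2 e by auto
    moreover have "(1/2)\<^sup>2 + (1/2)\<^sup>2 + (1/2 - \<beta>)\<^sup>2 + (1/2 - \<tau>)\<^sup>2 + 2 * \<beta>\<^sup>2 + 2 * \<tau>\<^sup>2 = 1"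
      using area unfolding 2 e by (simp add: power2_eq_square algebra_simps)
    ultimately show False using diag pos by blast
  qed
qed

lemma card_gt_of_sum:
  fixes s :: "'i \<Rightarrow> real"
  assumes "finite A" "\<And>i. i \<in> A \<Longrightarrow> s i < m" "real n * m \<le> sum s A" "0 < n" "0 < m"
  shows "n < card A"
proof (rule ccontr)
  assume "\<not> n < card A"
  then have "real (card A) * m \<le> real n * m" using assms(5) by (intro mult_right_mono) auto
  moreover have "card A \<noteq> 0"
  proof
    assume "card A = 0"
    then have "A = {}" using assms(1) by simp
    then show False using assms(3,4,5) by (simp add: mult_le_0_iff)
  qed
  then have "sum s A < real (card A) * m"
    using assms(2) by (intro sum_bounded_above_strict) auto
  ultimately show False using assms(3) by linarith
qed

context square_tiling
begin

lemma same_corner: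
  assumes "i \<in> I" "j \<in> I" "x i = x j \<or> x i + s i = x j + s j" "y i = y j \<or> y i + s i = y j + s j"
  shows "i = j"
proof (rule ccontr)
  assume "i \<noteq> j"
  from sep[OF assms(1,2) this] assms pos[of i] pos[of j] show False by auto
qed

lemma corner_bound:
  assumes "card I = 8" "i \<in> I" "x i = 0" "y i = 0" "1/2 < s i"
  shows "sum s I \<le> 13/5"
proof -
  interpret big_corner I x y s i
    by unfold_locales (use assms in auto)
  show ?thesis by (rule big_corner_bound)
qed

text \<open>The six squares of \<open>R\<close> tile the upper half; \<open>T\<close> touches the
  top, \<open>D\<close> rests on the middle line, and \<open>T \<inter> D\<close> holds those of
  side 1/2. With two of these, \<open>sum_mult_diff_le\<close> gives total side at most 5/2. With
  one, either no square lies outside \<open>T \<union> D\<close> and the total is 5/2, or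
  Cauchy-Schwarz makes the area too large. With none, three squares each in \<open>T\<close> and
  \<open>D\<close> already have area at least 2/3.\<close>

lemma half_bottom_bound:
  assumes "card I = 8" and AB: "A \<in> I" "B \<in> I" "A \<noteq> B" "y A = 0" "y B = 0" "s A = 1/2" "s B = 1/2"
  shows "sum s I \<le> 13/5"
proof -
  define R where "R = I - {A, B}"
  define T where "T = {i\<in>R. y i + s i = 1}"
  define D where "D = {i\<in>R. y i = 1/2}"
  have fR: "finite R" "R \<subseteq> I" using fin by (auto simp: R_def)
  have fT: "finite T" "finite D" "T \<subseteq> R" "D \<subseteq> R" using fR by (auto simp: T_def D_def)
  have cR: "card R = 6" using assms(1) AB by (simp add: R_def card_Diff_subset)
  have sumR: "sum g I = g A + g B + sum g R" for g :: "'i \<Rightarrow> real"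
    unfolding R_def using fin AB by (simp add: sum_diff)
  have up: "1/2 \<le> y i" if "i \<in> R" for i
  proof (rule ccontr)
    assume lt: "\<not> 1/2 \<le> y i"
    have i: "i \<in> I" "i \<noteq> A" "i \<noteq> B" using that by (auto simp: R_def)
    \<comment> \<open>The line along the lower side of \<open>i\<close> would cross
      \<open>A\<close>, \<open>B\<close> and \<open>i\<close>, of total side above 1.\<close>
    let ?X = "{j\<in>I. y j \<le> y i \<and> y i < y j + s j}"
    have "sum s {A, B, i} \<le> sum s ?X"
      using lt i AB bounds[OF i(1)] pos fin by (intro sum_mono2) (auto simp: less_imp_le)
    moreover have "sum s ?X = 1" using lt bounds[OF i(1)] by (intro sum_crossing) auto
    ultimately show False using AB i pos[OF i(1)] by simp
  qed
  have half: "s i \<le> 1/2" if "i \<in> R" for i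
    using up[OF that] bounds[of i] that fR(2) by auto
  have sT: "sum s T = 1"
  proof -
    have "T = {i\<in>I. y i + s i = 1}" using AB by (auto simp: T_def R_def)
    then show ?thesis using sum_top by simp
  qed
  have sD: "sum s D = 1"
  proof -
    have "D = {i\<in>I. y i \<le> 1/2 \<and> 1/2 < y i + s i}"
    proof (rule set_eqI)
      fix i show "i \<in> D \<longleftrightarrow> i \<in> {i\<in>I. y i \<le> 1/2 \<and> 1/2 < y i + s i}"
        using up[of i] pos[of i] AB fR(2) by (cases "i \<in> {A, B}") (auto simp: D_def R_def)
    qed
    then show ?thesis using sum_crossing[of "1/2"] by simp
  qed
  have area': "(\<Sum>i\<in>R. (s i)\<^sup>2) = 1/2"
    using sumR[of "\<lambda>i. (s i)\<^sup>2"] area AB by (simp add: power2_eq_square)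
  have full: "T \<inter> D = {i\<in>R. s i = 1/2}"
  proof (rule set_eqI)
    fix i show "i \<in> T \<inter> D \<longleftrightarrow> i \<in> {i\<in>R. s i = 1/2}"
      using up[of i] bounds[of i] fR(2) by (auto simp: T_def D_def)
  qed
  have cs: "(sum s A)\<^sup>2 \<le> real (card A) * (\<Sum>i\<in>A. (s i)\<^sup>2)" for A
    using sum_squared_le_sum_of_squares[of s A] by (simp add: mult.commute)
  have S: "sum s I = 1 + sum s R" using sumR[of s] AB by simp
  consider "2 \<le> card (T \<inter> D)" | "card (T \<inter> D) = Suc 0" | "card (T \<inter> D) = 0" by linarith
  then show ?thesis
  proof cases
    case 1
    have "(\<Sum>i\<in>R. s i * (1/2 - s i)) \<le> real (card (R - T \<inter> D)) * ((1/2)\<^sup>2 / 4)"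
      using fR(1) full by (intro sum_mult_diff_le) auto
    moreover have "card (R - T \<inter> D) \<le> 4"
      using 1 cR fT by (subst card_Diff_subset) auto
    moreover have "(\<Sum>i\<in>R. s i * (1/2 - s i)) = sum s R / 2 - 1/2"
      using area' by (simp add: right_diff_distrib sum_subtractf sum_divide_distrib power2_eq_square)
    ultimately show ?thesis using S by (simp add: power2_eq_square)
  next
    case 2
    then obtain k where k: "T \<inter> D = {k}" using card_1_obtain by blast
    define T' where "T' = T - {k}"
    define D' where "D' = D - {k}"
    have kk: "k \<in> T" "k \<in> D" "k \<in> R" "s k = 1/2" using k full by auto
    have f': "finite T'" "finite D'" "T' \<inter> D' = {}" using fT k by (auto simp: T'_def D'_def)
    have s': "sum s T' = 1/2" "sum s D' = 1/2"
      using kk fT sT sD by (simp_all add: T'_def D'_def sum_diff1)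
    have lt: "s i < 1/2" if "i \<in> T' \<union> D'" for i
    proof -
      have "i \<in> R" "i \<notin> T \<inter> D" using that k fT by (auto simp: T'_def D'_def)
      then show ?thesis using half[of i] full by auto
    qed
    have c': "1 < card T'" "1 < card D'"
      using lt s' f' by (auto intro!: card_gt_of_sum[where m = "1/2" and s = s])
    define J where "J = R - insert k (T' \<union> D')"
    have sub: "insert k (T' \<union> D') \<subseteq> R" "k \<notin> T' \<union> D'"
      using kk fT by (auto simp: T'_def D'_def)
    have sumR': "sum g R = g k + sum g T' + sum g D' + sum g J" for g :: "'i \<Rightarrow> real"
    proof -
      have "sum g R = sum g J + sum g (insert k (T' \<union> D'))"
        unfolding J_def by (rule sum.subset_diff[OF sub(1) fR(1)])
      then show ?thesis using sub(2) f' by (simp add: sum.union_disjoint)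
    qed
    have cardR: "card T' + card D' + card J = 5"
    proof -
      have "card J = card R - card (insert k (T' \<union> D'))"
        unfolding J_def using sub f' by (intro card_Diff_subset) auto
      moreover have "card (insert k (T' \<union> D')) \<le> card R"
        by (rule card_mono[OF fR(1) sub(1)])
      moreover have "card (insert k (T' \<union> D')) = Suc (card T' + card D')"
        using sub(2) f' by (simp add: card_Un_disjoint)
      ultimately show ?thesis using cR by linarith
    qed
    have fJ: "finite J" using fR(1) by (simp add: J_def)
    show ?thesis
    proof (cases "J = {}")
      case True
      then show ?thesis using S sumR'[of s] s' kk by simp
    next
      case False
      then have "0 < card J" using fJ by (simp add: card_gt_0_iff)
      then have "card T' = 2" "card D' = 2" using c' cardR by linarith+
      then have "1/8 \<le> (\<Sum>i\<in>T'. (s i)\<^sup>2)" "1/8 \<le> (\<Sum>i\<in>D'. (s i)\<^sup>2)"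
        using cs[of T'] cs[of D'] s' by (simp_all add: power2_eq_square)
      moreover have "0 < (\<Sum>i\<in>J. (s i)\<^sup>2)"
      proof (rule sum_pos[OF fJ False])
        fix i assume "i \<in> J"
        then show "0 < (s i)\<^sup>2" using pos[of i] fR(2) by (auto simp: J_def)
      qed
      ultimately have False
        using area' sumR'[of "\<lambda>i. (s i)\<^sup>2"] kk by (simp add: power2_eq_square)
      then show ?thesis ..
    qed
  next
    case 3
    then have e: "T \<inter> D = {}" using fT by simp
    have lt: "s i < 1/2" if "i \<in> T \<union> D" for i
    proof -
      have "i \<in> R" "i \<notin> T \<inter> D" using that e fT by auto
      then show ?thesis using half[of i] full by auto
    qed
    have "2 < card T" "2 < card D"
      using lt sT sD fT by (auto intro!: card_gt_of_sum[where m = "1/2" and s = s])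
    moreover have "card T + card D \<le> 6"
      using card_mono[OF fR(1), of "T \<union> D"] fT e cR by (simp add: card_Un_disjoint)
    ultimately have "card T = 3" "card D = 3" by linarith+
    then have "1/3 \<le> (\<Sum>i\<in>T. (s i)\<^sup>2)" "1/3 \<le> (\<Sum>i\<in>D. (s i)\<^sup>2)"
      using cs[of T] cs[of D] sT sD by simp_all
    moreover have "(\<Sum>i\<in>T. (s i)\<^sup>2) + (\<Sum>i\<in>D. (s i)\<^sup>2) \<le> (\<Sum>i\<in>R. (s i)\<^sup>2)"
      using fT fR e by (subst sum.union_disjoint[symmetric]) (auto intro!: sum_mono2)
    ultimately have False using area' by linarith
    then show ?thesis ..
  qed
qed

text \<open>The square \<open>r\<close> following the leftmost square \<open>l\<close> on the line
  starts to the right of 0, so it must reach the right side; it begins exactly where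
  \<open>l\<close> ends.\<close>

lemma line_two_squares:
  assumes "0 \<le> t" "t < 1" "\<And>i. i \<in> I \<Longrightarrow> s i < 1"
    and "\<And>i. i \<in> I \<Longrightarrow> y i \<le> t \<Longrightarrow> t < y i + s i \<Longrightarrow> x i = 0 \<or> x i + s i = 1"
  obtains l r where "l \<in> I" "r \<in> I" "x l = 0" "x r + s r = 1" "s l + s r = 1"
proof -
  obtain l where l: "l \<in> I" "x l \<le> 0" "y l \<le> t" "t < y l + s l"
    using half_open_cover[of 0 t] assms(1,2) by auto
  then have xl: "x l = 0" using bounds[of l] by auto
  obtain r where r: "r \<in> I" "x r \<le> s l" "s l < x r + s r" "y r \<le> t" "t < y r + s r"
    using half_open_cover[of "s l" t] assms(1,2) assms(3)[OF l(1)] pos[OF l(1)] by auto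
  have "l \<noteq> r" using r xl by auto
  with sep[OF l(1) r(1)] l r xl have "s l \<le> x r" using pos[of l] by auto
  moreover from this have "x r + s r = 1" using assms(4)[OF r(1,4,5)] pos[OF l(1)] by auto
  ultimately show ?thesis using that[of l r] l r xl by simp
qed

text \<open>Otherwise \<open>A\<close> and \<open>B\<close> fill the bottom, both have side 1/2, and
  \<open>half_bottom_bound\<close> applies.\<close>

lemma middle_square:
  assumes "card I = 8" "A \<in> I" "B \<in> I" "A \<noteq> B" "y A = 0" "y B = 0" "s A \<le> 1/2" "s B \<le> 1/2"
    and "13/5 < sum s I"
  shows "\<exists>m\<in>I. y m = 0 \<and> m \<noteq> A \<and> m \<noteq> B"
proof (rule ccontr)
  assume "\<not> ?thesis"
  then have "{i\<in>I. y i = 0} = {A, B}" using assms(2,3,5,6) by blast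
  then have "s A + s B = 1" using sum_bottom assms(4) by simp
  then have "s A = 1/2" "s B = 1/2" using assms by linarith+
  from half_bottom_bound[OF assms(1-6) this] assms(9) show False by simp
qed

text \<open>The bottom square \<open>m\<close> and the right square \<open>n\<close> are separated
  horizontally, so that \<open>A\<close>, \<open>m\<close>, \<open>n\<close> fit side by side, or
  vertically, so that \<open>m\<close>, \<open>n\<close>, \<open>C\<close> fit above each
  other.\<close>

lemma adjacent_middles:
  assumes "A \<in> I" "C \<in> I" "m \<in> I" "n \<in> I"
    "x A = 0" "y A = 0" "y m = 0" "x n + s n = 1" "x C + s C = 1" "y C + s C = 1"
    "m \<noteq> A" "n \<noteq> C" "m \<noteq> n"
  shows "s A + s m + s n \<le> 1 \<or> s C + s m + s n \<le> 1"
  using assms sep[of A m] sep[of n C] sep[of m n] pos[of A] pos[of C] pos[of m] pos[of n]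
    bounds[of m] bounds[of n] by auto

lemma small_corners_impossible:
  assumes card_I: "card I = 8" and gt: "13/5 < sum s I"
    and A: "A \<in> I" "x A = 0" "y A = 0" "s A \<le> 1/2"
    and B: "B \<in> I" "x B + s B = 1" "y B = 0" "s B \<le> 1/2"
    and C: "C \<in> I" "x C + s C = 1" "y C + s C = 1" "s C \<le> 1/2"
    and D: "D \<in> I" "x D = 0" "y D + s D = 1" "s D \<le> 1/2"
  shows False
proof -
  have ne: "A \<noteq> B" "A \<noteq> C" "A \<noteq> D" "B \<noteq> C" "B \<noteq> D" "C \<noteq> D"
    using A B C D by auto
  have uA: "i = A" if "i \<in> I" "x i = 0" "y i = 0" for i
    using same_corner[OF that(1) A(1)] that A by auto
  have uB: "i = B" if "i \<in> I" "x i + s i = 1" "y i = 0" for i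
    using same_corner[OF that(1) B(1)] that B by auto
  have uC: "i = C" if "i \<in> I" "x i + s i = 1" "y i + s i = 1" for i
    using same_corner[OF that(1) C(1)] that C by auto
  have uD: "i = D" if "i \<in> I" "x i = 0" "y i + s i = 1" for i
    using same_corner[OF that(1) D(1)] that D by auto
  have lt1: "s i < 1" if "i \<in> I" for i
  proof (rule ccontr)
    assume "\<not> s i < 1"
    then have "s i = 1" "x i = 0" "y i = 0" using bounds[OF that] by auto
    then show False using uA[OF that] A by simp
  qed
  note sq = swap flip_x flip_y square_tiling.swap[OF flip_x] square_tiling.flip_y[OF flip_x]
  have flip0: "1 - y C - s C = 0" "1 - y D - s D = 0" "1 - x B - s B = 0" "1 - x C - s C = 0"
    using B C D by simp_all
  obtain b where b: "b \<in> I" "y b = 0" "b \<noteq> A" "b \<noteq> B"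
    using middle_square[OF card_I A(1) B(1) ne(1) A(3) B(3) A(4) B(4) gt] by blast
  obtain t where t: "t \<in> I" "1 - y t - s t = 0" "t \<noteq> C" "t \<noteq> D"
    using square_tiling.middle_square[OF sq(3) card_I C(1) D(1) ne(6) flip0(1,2) C(4) D(4) gt] by blast
  obtain l where l: "l \<in> I" "x l = 0" "l \<noteq> A" "l \<noteq> D"
    using square_tiling.middle_square[OF sq(1) card_I A(1) D(1) ne(3) A(2) D(2) A(4) D(4) gt] by blast
  obtain r where r: "r \<in> I" "1 - x r - s r = 0" "r \<noteq> B" "r \<noteq> C"
    using square_tiling.middle_square[OF sq(4) card_I B(1) C(1) ne(4) flip0(3,4) B(4) C(4) gt] by blast
  have t2: "y t + s t = 1" and r2: "x r + s r = 1" using t(2) r(2) by simp_all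
  have y0: "y C \<noteq> 0" "y D \<noteq> 0" "y t \<noteq> 0" "y l \<noteq> 0" "y r \<noteq> 0"
    using C(3,4) D(3,4) t2 lt1[OF t(1)] uA[OF l(1,2)] l(3) uB[OF r(1) r2] r(3) by auto
  have y1: "y A + s A \<noteq> 1" "y B + s B \<noteq> 1" "y b + s b \<noteq> 1" "y l + s l \<noteq> 1" "y r + s r \<noteq> 1"
    using A(3,4) B(3,4) b(2) lt1[OF b(1)] uD[OF l(1,2)] l(4) uC[OF r(1) r2] r(4) by auto
  have x0: "x B \<noteq> 0" "x C \<noteq> 0" "x r \<noteq> 0" "x b \<noteq> 0" "x t \<noteq> 0"
    using B(2,4) C(2,4) r2 lt1[OF r(1)] uA[OF b(1) _ b(2)] b(3) uD[OF t(1) _ t2] t(4) by auto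
  have x1: "x A + s A \<noteq> 1" "x D + s D \<noteq> 1" "x l + s l \<noteq> 1" "x b + s b \<noteq> 1" "x t + s t \<noteq> 1"
    using A(2,4) D(2,4) l(2) lt1[OF l(1)] uB[OF b(1) _ b(2)] b(4) uC[OF t(1) _ t2] t(3) by auto
  have ne': "b \<noteq> C" "b \<noteq> D" "b \<noteq> t" "b \<noteq> l" "b \<noteq> r" "t \<noteq> A" "t \<noteq> B" "t \<noteq> l" "t \<noteq> r"
    "l \<noteq> B" "l \<noteq> C" "l \<noteq> r" "r \<noteq> A" "r \<noteq> D"
    using b(2) l(2) t2 r2 y0 y1 x0 x1 A(2,3) B(2,3) C(2,3) D(2,3) by auto
  \<comment> \<open>Four corner squares and one further square on each side already make eight, so
    no square is interior and no side has a fourth square.\<close>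
  have I: "I = {A, B, C, D, b, t, l, r}"
  proof (rule card_subset_eq[OF fin, symmetric])
    show "{A, B, C, D, b, t, l, r} \<subseteq> I" using A(1) B(1) C(1) D(1) b(1) t(1) l(1) r(1) by simp
    have "card {A, B, C, D, b, t, l, r} = 8"
      using ne ne' b(3,4) t(3,4) l(3,4) r(3,4) by (simp add: card_insert_if)
    then show "card {A, B, C, D, b, t, l, r} = card I" using card_I by simp
  qed
  have Bo: "{i\<in>I. y i = 0} = {A, b, B}" using I y0 A(3) B(3) b(2) by auto
  have To: "{i\<in>I. y i + s i = 1} = {D, t, C}" using I y1 D(3) C(3) t2 by auto
  have Le: "{i\<in>I. x i = 0} = {A, l, D}" using I x0 A(2) D(2) l(2) by auto
  have Ri: "{i\<in>I. x i + s i = 1} = {B, r, C}" using I x1 B(2) C(2) r2 by auto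
  have sides: "s A + s B + s b = 1" "s D + s C + s t = 1" "s A + s D + s l = 1" "s B + s C + s r = 1"
    using sum_bottom sum_top sum_left sum_right unfolding Bo To Le Ri using ne ne' b(3,4) t(3,4) l(3,4) r(3,4) by simp_all
  have area': "(s A)\<^sup>2 + (s B)\<^sup>2 + (s C)\<^sup>2 + (s D)\<^sup>2 + (s b)\<^sup>2 + (s t)\<^sup>2 + (s l)\<^sup>2 + (s r)\<^sup>2 = 1"
    using area ne ne' b(3,4) t(3,4) l(3,4) r(3,4) unfolding I by simp
  show False
  proof (rule pinwheel_impossible[OF pos[OF A(1)] pos[OF B(1)] pos[OF C(1)] pos[OF D(1)]
        pos[OF b(1)] pos[OF t(1)] pos[OF l(1)] pos[OF r(1)] A(4) B(4) C(4) D(4) sides area'])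
    show "s A + s b + s r \<le> 1 \<or> s C + s b + s r \<le> 1"
      by (rule adjacent_middles) (use A C b r r2 ne' in auto)
    show "s B + s r + s t \<le> 1 \<or> s D + s r + s t \<le> 1"
      using square_tiling.adjacent_middles[OF sq(3), of D B t r] B D t r r2 ne' by (auto simp: add_ac)
    show "s A + s t + s l \<le> 1 \<or> s C + s t + s l \<le> 1"
      using square_tiling.adjacent_middles[OF sq(5), of C A t l] A C t l ne' by (auto simp: add_ac)
    show "s B + s l + s b \<le> 1 \<or> s D + s l + s b \<le> 1"
      using square_tiling.adjacent_middles[OF sq(2), of B D b l] B D b l ne' by (auto simp: add_ac)
    show "\<exists>u\<in>{s A, s l, s D}. \<exists>v\<in>{s B, s r, s C}. u + v = 1" if lt: "s b + s t < 1"
    proof -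
      \<comment> \<open>The line at height \<open>s b\<close> is the upper side of \<open>b\<close>,
        which the half-open convention does not count, and it runs below \<open>t\<close>. All other
        squares touch the left or the right side.\<close>
      have "x i = 0 \<or> x i + s i = 1" if "i \<in> I" "y i \<le> s b" "s b < y i + s i" for i
      proof -
        have "i \<noteq> b" "i \<noteq> t" using that b(2) t2 lt by auto
        then have "i \<in> {A, l, D} \<or> i \<in> {B, r, C}" using that(1) unfolding I by blast
        then show ?thesis unfolding Le[symmetric] Ri[symmetric] by blast
      qed
      from line_two_squares[OF less_imp_le[OF pos[OF b(1)]] lt1[OF b(1)] lt1 this]
      obtain u v where "u \<in> I" "v \<in> I" "x u = 0" "x v + s v = 1" "s u + s v = 1" .
      moreover from this have "u \<in> {A, l, D}" "v \<in> {B, r, C}" using Le Ri by auto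
      ultimately show ?thesis by auto
    qed
    show "\<exists>u\<in>{s A, s b, s B}. \<exists>v\<in>{s D, s t, s C}. u + v = 1" if lt: "s l + s r < 1"
    proof -
      have "y i = 0 \<or> y i + s i = 1" if "i \<in> I" "x i \<le> s l" "s l < x i + s i" for i
      proof -
        have "i \<noteq> l" "i \<noteq> r" using that l(2) r2 lt by auto
        then have "i \<in> {A, b, B} \<or> i \<in> {D, t, C}" using that(1) unfolding I by blast
        then show ?thesis unfolding Bo[symmetric] To[symmetric] by blast
      qed
      from square_tiling.line_two_squares[OF sq(1) less_imp_le[OF pos[OF l(1)]] lt1[OF l(1)] lt1 this]
      obtain u v where "u \<in> I" "v \<in> I" "y u = 0" "y v + s v = 1" "s u + s v = 1" .
      moreover from this have "u \<in> {A, b, B}" "v \<in> {D, t, C}" using Bo To by auto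
      ultimately show ?thesis by auto
    qed
  qed
qed

lemma tiling_bound:
  assumes "card I = 8"
  shows "sum s I \<le> 13/5"
proof (rule ccontr)
  assume "\<not> ?thesis"
  then have gt: "13/5 < sum s I" by simp
  note sq = flip_x flip_y square_tiling.flip_y[OF flip_x]
  obtain A where A: "A \<in> I" "x A = 0" "y A = 0" using bottom_left_corner by blast
  obtain B where B: "B \<in> I" "1 - x B - s B = 0" "y B = 0"
    using square_tiling.bottom_left_corner[OF sq(1)] by blast
  obtain C where C: "C \<in> I" "1 - x C - s C = 0" "1 - y C - s C = 0"
    using square_tiling.bottom_left_corner[OF sq(3)] by blast
  obtain D where D: "D \<in> I" "x D = 0" "1 - y D - s D = 0"
    using square_tiling.bottom_left_corner[OF sq(2)] by blast
  have half: "s A \<le> 1/2" "s B \<le> 1/2" "s C \<le> 1/2" "s D \<le> 1/2"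
    using corner_bound[OF assms A] square_tiling.corner_bound[OF sq(1) assms B]
      square_tiling.corner_bound[OF sq(3) assms C] square_tiling.corner_bound[OF sq(2) assms D] gt
    by linarith+
  show False
    by (rule small_corners_impossible[OF assms gt, of A B C D]) (use A B C D half in auto)
qed

end

section \<open>The two maxima\<close>

lemma square_subset_iff:
  fixes a b s :: real
  assumes "0 < s"
  shows "right_square (a, b) s \<subseteq> unit_square \<longleftrightarrow> 0 \<le> a \<and> a + s \<le> 1 \<and> 0 \<le> b \<and> b + s \<le> 1"
proof
  assume "right_square (a, b) s \<subseteq> unit_square"
  moreover have "(a, b) \<in> right_square (a, b) s" "(a + s, b + s) \<in> right_square (a, b) s"
    using assms by (simp_all add: right_square_def cbox_Pair_iff)
  ultimately have "(a, b) \<in> unit_square" "(a + s, b + s) \<in> unit_square" by blast+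
  then show "0 \<le> a \<and> a + s \<le> 1 \<and> 0 \<le> b \<and> b + s \<le> 1"
    by (simp add: cbox_Pair_iff)
next
  assume "0 \<le> a \<and> a + s \<le> 1 \<and> 0 \<le> b \<and> b + s \<le> 1"
  then show "right_square (a, b) s \<subseteq> unit_square"
    by (auto simp: right_square_def cbox_Pair_iff)
qed

lemma squares_disjoint_iff:
  fixes x y s :: "'i \<Rightarrow> real"
  assumes "0 < s i" "0 < s j"
  shows "interior (right_square (x i, y i) (s i)) \<inter> interior (right_square (x j, y j) (s j)) = {}
    \<longleftrightarrow> separated x y s i j"
proof
  assume e: "interior (right_square (x i, y i) (s i)) \<inter> interior (right_square (x j, y j) (s j)) = {}"
  show "separated x y s i j"
  proof (rule ccontr)
    assume "\<not> ?thesis"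
    then have "max (x i) (x j) < min (x i + s i) (x j + s j)" "max (y i) (y j) < min (y i + s i) (y j + s j)"
      using assms by auto
    then obtain u v where "max (x i) (x j) < u" "u < min (x i + s i) (x j + s j)"
      "max (y i) (y j) < v" "v < min (y i + s i) (y j + s j)"
      using dense by metis
    then have "(u, v) \<in> interior (right_square (x i, y i) (s i)) \<inter> interior (right_square (x j, y j) (s j))"
      by (simp add: right_square_def interior_cbox mem_box_pair)
    then show False using e by blast
  qed
qed (auto simp: right_square_def interior_cbox mem_box_pair)

lemma right_packing_iff:
  "right_packing n (\<lambda>i. (x i, y i)) s \<longleftrightarrow>
    (\<forall>i<n. 0 < s i \<and> 0 \<le> x i \<and> x i + s i \<le> 1 \<and> 0 \<le> y i \<and> y i + s i \<le> 1) \<and>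
    (\<forall>i<n. \<forall>j<n. i \<noteq> j \<longrightarrow> separated x y s i j)"
proof (cases "\<forall>i<n. 0 < s i")
  case True
  then show ?thesis
    unfolding right_packing_def disjoint_family_on_def
    using square_subset_iff[of "s _"] squares_disjoint_iff[of s _ _ x y] by (simp add: Ball_def)
qed (auto simp: right_packing_def)

lemma right_tiling_iff:
  "right_tiling n (\<lambda>i. (x i, y i)) s \<longleftrightarrow> square_tiling {..<n} x y s"
proof -
  have cov: "(\<Union>i<n. right_square (x i, y i) (s i)) = unit_square \<longleftrightarrow>
      (\<forall>u v. 0 \<le> u \<longrightarrow> u \<le> 1 \<longrightarrow> 0 \<le> v \<longrightarrow> v \<le> 1 \<longrightarrow>
        (\<exists>i\<in>{..<n}. x i \<le> u \<and> u \<le> x i + s i \<and> y i \<le> v \<and> v \<le> y i + s i))" (is "?L \<longleftrightarrow> ?R")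
    if p: "right_packing n (\<lambda>i. (x i, y i)) s"
  proof -
    have "(\<Union>i<n. right_square (x i, y i) (s i)) \<subseteq> unit_square"
      using p unfolding right_packing_def by blast
    then have "?L \<longleftrightarrow> unit_square \<subseteq> (\<Union>i<n. right_square (x i, y i) (s i))" by blast
    also have "\<dots> \<longleftrightarrow> ?R"
      unfolding subset_iff split_paired_All
      by (simp add: right_square_def cbox_Pair_iff Bex_def imp_conjL)
    finally show ?thesis .
  qed
  show ?thesis
    unfolding right_tiling_def square_tiling_def
    using cov right_packing_iff[of n x y s] by auto
qed

section \<open>Compactness and the maximum over packings\<close>

lemma compact_PiE_UNIV:
  fixes S :: "'i \<Rightarrow> 'a::topological_space set"
  assumes "\<And>i. compact (S i)"
  shows "compact (PiE UNIV S)"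
  using compactin_PiE[of "\<lambda>_. euclidean" UNIV S] assms
  unfolding euclidean_product_topology compactin_euclidean_iff by auto

text \<open>Sides may be zero, which makes the condition closed. Position and side form one triple
  \<open>(x, y, s)\<close> per index, so a packing is a single point of a product space.\<close>

definition weak_packing :: "nat \<Rightarrow> (nat \<Rightarrow> real \<times> real \<times> real) \<Rightarrow> bool" where
  "weak_packing n q \<longleftrightarrow>
    (\<forall>i\<in>{..<n}. 0 \<le> snd (snd (q i)) \<and>
      0 \<le> fst (q i) \<and> fst (q i) + snd (snd (q i)) \<le> 1 \<and>
      0 \<le> fst (snd (q i)) \<and> fst (snd (q i)) + snd (snd (q i)) \<le> 1) \<and>
    (\<forall>i\<in>{..<n}. \<forall>j\<in>{..<n}. i \<noteq> j \<longrightarrow>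
      separated (\<lambda>i. fst (q i)) (\<lambda>i. fst (snd (q i))) (\<lambda>i. snd (snd (q i))) i j)"

lemma closed_Collect_Ball:
  assumes "\<And>i. i \<in> A \<Longrightarrow> closed {x. P i x}"
  shows "closed {x. \<forall>i\<in>A. P i x}"
proof -
  have "{x. \<forall>i\<in>A. P i x} = (\<Inter>i\<in>A. {x. P i x})" by auto
  then show ?thesis using assms by (simp add: closed_INT)
qed

lemma closed_weak_packing: "closed {q. weak_packing n q}"
proof -
  have c: "continuous_on UNIV (\<lambda>q. q i)" for i :: nat
    and q :: "nat \<Rightarrow> real \<times> real \<times> real"
    by (rule continuous_on_product_coordinates)
  have "closed {q :: nat \<Rightarrow> real \<times> real \<times> real. i \<noteq> j \<longrightarrow>
      separated (\<lambda>i. fst (q i)) (\<lambda>i. fst (snd (q i))) (\<lambda>i. snd (snd (q i))) i j}" for i j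
    by (cases "i = j")
      (auto intro!: closed_Collect_disj closed_Collect_le continuous_intros c)
  then show ?thesis
    unfolding weak_packing_def
    by (intro closed_Collect_conj closed_Collect_Ball closed_Collect_le continuous_intros c)
qed

lemma weak_packing_max:
  assumes "weak_packing n q0"
  obtains q where "weak_packing n q"
    "\<And>q'. weak_packing n q' \<Longrightarrow> (\<Sum>i<n. snd (snd (q' i))) \<le> (\<Sum>i<n. snd (snd (q i)))"
proof -
  define S :: "nat \<Rightarrow> (real \<times> real \<times> real) set" where
    "S i = (if i < n then cbox (0, 0, 0) (1, 1, 1) else {0})" for i
  define K where "K = PiE UNIV S \<inter> {q. weak_packing n q}"
  \<comment> \<open>Entries from index \<open>n\<close> on are irrelevant for packings; setting them
    to 0 moves every weak packing into a compact product without changing its total side.\<close>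
  define cut :: "(nat \<Rightarrow> real \<times> real \<times> real) \<Rightarrow> nat \<Rightarrow> real \<times> real \<times> real" where
    "cut q i = (if i < n then q i else 0)" for q i
  have cut: "cut q \<in> K" if "weak_packing n q" for q
  proof -
    have "cut q i \<in> S i" for i
    proof (cases "i < n")
      case True
      then have "0 \<le> snd (snd (q i)) \<and>
        0 \<le> fst (q i) \<and> fst (q i) + snd (snd (q i)) \<le> 1 \<and>
        0 \<le> fst (snd (q i)) \<and> fst (snd (q i)) + snd (snd (q i)) \<le> 1"
        using that by (simp add: weak_packing_def)
      then show ?thesis using True
        by (cases "q i") (auto simp: cut_def S_def cbox_Pair_iff)
    qed (simp add: cut_def S_def)
    moreover have "weak_packing n (cut q)"
      using that by (simp add: weak_packing_def cut_def)
    ultimately show ?thesis by (auto simp: K_def PiE_def)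
  qed
  have 1: "compact K"
    unfolding K_def by (intro compact_Int_closed compact_PiE_UNIV closed_weak_packing) (auto simp: S_def)
  have 2: "K \<noteq> {}" using cut[OF assms] by blast
  have 3: "continuous_on K (\<lambda>q. \<Sum>i<n. snd (snd (q i)))"
    by (intro continuous_intros continuous_on_subset[OF continuous_on_product_coordinates subset_UNIV])
  from continuous_attains_sup[OF 1 2 3] obtain q where q: "q \<in> K"
    "\<forall>q'\<in>K. (\<Sum>i<n. snd (snd (q' i))) \<le> (\<Sum>i<n. snd (snd (q i)))" ..
  have "(\<Sum>i<n. snd (snd (q' i))) \<le> (\<Sum>i<n. snd (snd (q i)))" if "weak_packing n q'" for q'
    using bspec[OF q(2) cut[OF that]] by (simp add: cut_def)
  then show ?thesis using that q(1) by (auto simp: K_def)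
qed

text \<open>The cells are numbered row by row from the bottom left; the omitted cell, number 8, is
  the top right one.\<close>

lemma weak_grid: "weak_packing 8 (\<lambda>i. (real (i mod 3) / 3, real (i div 3) / 3, 1/3))"
  unfolding weak_packing_def
proof (intro conjI ballI impI)
  fix i j :: nat assume ij: "i \<in> {..<8}" "j \<in> {..<8}" "i \<noteq> j"
  have "i mod 3 \<noteq> j mod 3 \<or> i div 3 \<noteq> j div 3"
    using ij(3) by (metis div_mult_mod_eq)
  then have "i mod 3 + 1 \<le> j mod 3 \<or> j mod 3 + 1 \<le> i mod 3 \<or> i div 3 + 1 \<le> j div 3 \<or> j div 3 + 1 \<le> i div 3"
    by linarith
  then show "separated (\<lambda>i. fst (real (i mod 3) / 3, real (i div 3) / 3, 1/3 :: real))
    (\<lambda>i. fst (snd (real (i mod 3) / 3, real (i div 3) / 3, 1/3 :: real)))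
    (\<lambda>i. snd (snd (real (i mod 3) / 3, real (i div 3) / 3, 1/3 :: real))) i j"
    by (simp add: field_simps) linarith
next
  fix i :: nat assume "i \<in> {..<8}"
  then have "i mod 3 \<le> 2" "i div 3 \<le> 2" by auto
  then show "fst (real (i mod 3) / 3, real (i div 3) / 3, 1/3 :: real) +
      snd (snd (real (i mod 3) / 3, real (i div 3) / 3, 1/3 :: real)) \<le> 1"
    "fst (snd (real (i mod 3) / 3, real (i div 3) / 3, 1/3 :: real)) +
      snd (snd (real (i mod 3) / 3, real (i div 3) / 3, 1/3 :: real)) \<le> 1"
    by (simp_all add: field_simps)
qed simp_all

lemma psi2_8_ge: "8/3 \<le> psi2 8"
proof -
  obtain q where q: "weak_packing 8 q" and
    max: "\<And>q'. weak_packing 8 q' \<Longrightarrow> (\<Sum>i<8. snd (snd (q' i))) \<le> (\<Sum>i<8. snd (snd (q i)))"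
    using weak_packing_max[OF weak_grid] by blast
  define x y s where "x i = fst (q i)" and "y i = fst (snd (q i))" and "s i = snd (snd (q i))" for i
  have wp: "\<forall>i<8. 0 \<le> s i \<and> 0 \<le> x i \<and> x i + s i \<le> 1 \<and> 0 \<le> y i \<and> y i + s i \<le> 1"
    "\<forall>i<8. \<forall>j<8. i \<noteq> j \<longrightarrow> separated x y s i j"
    using q unfolding weak_packing_def x_def y_def s_def by simp_all
  have ge: "8/3 \<le> (\<Sum>i<8. s i)" using max[OF weak_grid] by (simp add: s_def)
  \<comment> \<open>If one side vanished, the other seven, of area at most 1, would have total side
    at most the square root of 7 by Cauchy-Schwarz. But
    \<open>(8/3)\<^sup>2 = 64/9 > 7\<close>.\<close>
  have pos: "0 < s j" if j: "j < 8" for j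
  proof (rule ccontr)
    assume "\<not> 0 < s j"
    then have "s j = 0" using wp(1) j by (simp add: order.antisym)
    then have "(\<Sum>i<8. s i) = sum s ({..<8} - {j})"
      using j by (simp add: sum_diff1)
    also have "(sum s ({..<8} - {j}))\<^sup>2 \<le> (\<Sum>i\<in>{..<8} - {j}. (s i)\<^sup>2) * real (card ({..<8} - {j}))"
      by (rule sum_squared_le_sum_of_squares)
    also have "\<dots> \<le> 1 * 7"
    proof (rule mult_mono)
      show "(\<Sum>i\<in>{..<8} - {j}. (s i)\<^sup>2) \<le> 1"
        using wp by (intro sum_squares_le_1[of _ s x y]) auto
    qed (use j in simp_all)
    finally have "(\<Sum>i<8. s i)\<^sup>2 \<le> 7" by simp
    moreover have "(8/3)\<^sup>2 \<le> (\<Sum>i<8. s i)\<^sup>2" using ge by (intro power_mono) auto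
    ultimately show False by (simp add: power2_eq_square)
  qed
  have "psi2 8 = (\<Sum>i<8. s i)"
    unfolding psi2_def
  proof (rule Greatest_equality)
    have "right_packing 8 (\<lambda>i. (x i, y i)) s"
      unfolding right_packing_iff using wp pos by blast
    then show "\<exists>p s'. right_packing 8 p s' \<and> (\<Sum>i<8. s i) = (\<Sum>i<8. s' i)" by blast
    fix t assume "\<exists>p s'. right_packing 8 p s' \<and> t = (\<Sum>i<8. s' i)"
    then obtain p s' where p: "right_packing 8 p s'" "t = (\<Sum>i<8. s' i)" by blast
    have "right_packing 8 (\<lambda>i. (fst (p i), snd (p i))) s'" using p(1) by simp
    then have "weak_packing 8 (\<lambda>i. (fst (p i), snd (p i), s' i))"
      unfolding right_packing_iff weak_packing_def by (simp add: less_imp_le)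
    from max[OF this] show "t \<le> (\<Sum>i<8. s i)" using p(2) by (simp add: s_def)
  qed
  then show ?thesis using ge by simp
qed

section \<open>A tiling attaining 13/5 and the value of \<open>psi3 8\<close>\<close>

lemma ex_tiling_13_5:
  "\<exists>x y s. square_tiling {..<8::nat} x y s \<and> sum s {..<8} = 13/5"
proof -
  \<comment> \<open>A square of side 3/5 fills one corner and squares of side 2/5 the other three.
    Two gaps of size 1/5 by 2/5 remain and are halved.\<close>
  define x y s :: "nat \<Rightarrow> real"
    where "x i = [0, 3, 3, 4, 3, 0, 2, 2] ! i / 5"
      and "y i = [0, 0, 2, 2, 3, 3, 3, 4] ! i / 5"
      and "s i = [3, 2, 1, 1, 2, 2, 1, 1] ! i / 5" for i
  have set8: "{..<8::nat} = {0, 1, 2, 3, 4, 5, 6, 7}" by auto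
  have vals: "x 0 = 0" "y 0 = 0" "s 0 = 3/5" "x 1 = 3/5" "y 1 = 0" "s 1 = 2/5"
    "x 2 = 3/5" "y 2 = 2/5" "s 2 = 1/5" "x 3 = 4/5" "y 3 = 2/5" "s 3 = 1/5"
    "x 4 = 3/5" "y 4 = 3/5" "s 4 = 2/5" "x 5 = 0" "y 5 = 3/5" "s 5 = 2/5"
    "x 6 = 2/5" "y 6 = 3/5" "s 6 = 1/5" "x 7 = 2/5" "y 7 = 4/5" "s 7 = 1/5"
    unfolding x_def y_def s_def by simp_all
  have "sum s {..<8} = 13/5" unfolding set8 by (simp add: vals del: One_nat_def)
  moreover have "square_tiling {..<8} x y s"
  proof
    have "\<forall>i\<in>{0, 1, 2, 3, 4, 5, 6, 7}. 0 < s i \<and> 0 \<le> x i \<and> x i + s i \<le> 1 \<and> 0 \<le> y i \<and> y i + s i \<le> 1"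
      unfolding ball_simps vals by simp
    then show "0 < s i" "0 \<le> x i \<and> x i + s i \<le> 1 \<and> 0 \<le> y i \<and> y i + s i \<le> 1" if "i \<in> {..<8}" for i
      using that unfolding set8 by blast+
    have "\<forall>i\<in>{0, 1, 2, 3, 4, 5, 6, 7}. \<forall>j\<in>{0, 1, 2, 3, 4, 5, 6, 7}. i \<noteq> j \<longrightarrow> separated x y s i j"
      unfolding ball_simps vals by simp
    then show "separated x y s i j" if "i \<in> {..<8}" "j \<in> {..<8}" "i \<noteq> j" for i j
      using that unfolding set8 by blast
    fix u v :: real assume uv: "0 \<le> u" "u \<le> 1" "0 \<le> v" "v \<le> 1"
    \<comment> \<open>The regions are the four corner squares and the two gaps; in a gap, a
      comparison with 4/5 selects the half.\<close>
    consider "u \<le> 3/5" "v \<le> 3/5" | "3/5 \<le> u" "v \<le> 2/5" | "3/5 \<le> u" "2/5 \<le> v" "v \<le> 3/5" | "3/5 \<le> u" "3/5 \<le> v"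
      | "u \<le> 2/5" "3/5 \<le> v" | "2/5 \<le> u" "u \<le> 3/5" "3/5 \<le> v" by argo
    then show "\<exists>i\<in>{..<8}. x i \<le> u \<and> u \<le> x i + s i \<and> y i \<le> v \<and> v \<le> y i + s i"
    proof cases
      case 1 then show ?thesis using uv by (intro bexI[of _ 0]) (auto simp: vals simp del: One_nat_def)
    next
      case 2 then show ?thesis using uv by (intro bexI[of _ 1]) (auto simp: vals simp del: One_nat_def)
    next
      case 3 then show ?thesis using uv
        by (cases "u \<le> 4/5"; intro bexI[of _ "if u \<le> 4/5 then 2 else 3"]) (auto simp: vals simp del: One_nat_def)
    next
      case 4 then show ?thesis using uv by (intro bexI[of _ 4]) (auto simp: vals simp del: One_nat_def)
    next
      case 5 then show ?thesis using uv by (intro bexI[of _ 5]) (auto simp: vals simp del: One_nat_def)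
    next
      case 6 then show ?thesis using uv
        by (cases "v \<le> 4/5"; intro bexI[of _ "if v \<le> 4/5 then 6 else 7"]) (auto simp: vals simp del: One_nat_def)
    qed
  qed simp
  ultimately show ?thesis by blast
qed

lemma psi3_8: "psi3 8 = 13/5"
  unfolding psi3_def
proof (rule Greatest_equality)
  show "\<exists>p s. right_tiling 8 p s \<and> 13/5 = (\<Sum>i<8. s i)"
  proof -
    obtain x y s where "square_tiling {..<8::nat} x y s" and sum: "sum s {..<8} = 13/5"
      using ex_tiling_13_5 by blast
    then have "right_tiling 8 (\<lambda>i. (x i, y i)) s" by (simp only: right_tiling_iff)
    with sum[symmetric] show ?thesis by blast
  qed
  fix t assume "\<exists>p s. right_tiling 8 p s \<and> t = (\<Sum>i<8. s i)"
  then obtain p s where p: "right_tiling 8 p s" "t = (\<Sum>i<8. s i)" by blast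
  have "right_tiling 8 (\<lambda>i. (fst (p i), snd (p i))) s" using p(1) by simp
  then have "square_tiling {..<8} (\<lambda>i. fst (p i)) (\<lambda>i. snd (p i)) s"
    unfolding right_tiling_iff .
  from square_tiling.tiling_bound[OF this] show "t \<le> 13/5" using p(2) by simp
qed

theorem theorem6: "psi2 8 > psi3 8"
  using psi2_8_ge psi3_8 by simp

end
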